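(* (i) Let $q\in\{0,\dots,d\}$, $r>0$, $T>0$. If $\mathcal A$ is a degree-$q$, radius-$r$ homological certificate for $M$, then $H_T(\mathcal A)\subseteq R_q(T,r)$; if $\mathcal A$ is a full homological certificate at radius $r$, then $H_T(\mathcal A)\subseteq R(T,r)$. (ii) There exist constants $C_{low},C_{up},\varepsilon_0>0$ such that for every $0<\varepsilon<\varepsilon_0$ and every intrinsic $\varepsilon$-net $\{x_1,\ldots,x_N\}$ of $M$ with $N=N_\varepsilon(M)$, the family $$\mathcal A_\varepsilon=\{B_M(x_1,\varepsilon),\ldots,B_M(x_N,\varepsilon)\}$$ is a full homological certificate at every radius $r$ with $C_{low}\,\varepsilon\le r\le C_{up}\operatorname{reach}(M)$. In particular, full certificates of size $N_\varepsilon(M)$ exist.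
   Context: Setting. $d\ge2$; homology has coefficients in a fixed field. $M\subset\mathbb R^d$ is the closure of a bounded connected open set. $d_M(x,y)$ is the infimum of the lengths of rectifiable curves in $M$ joining $x$ to $y$; $B_M(x,\varepsilon)=\{y\in M:d_M(x,y)<\varepsilon\}$; $\mu(A)=|A|/|M|$ is normalized Lebesgue measure on $M$. $M$ satisfies: (1) positive reach: $\operatorname{reach}(M)>0$, i.e. every $z$ with $0<\operatorname{dist}(z,M)<\operatorname{reach}(M)$ has a unique nearest point in $M$; (2) there are $c_{ie}\ge1$, $\rho_{ie}>0$ with $d_M(x,y)\le c_{ie}|x-y|$ whenever $x,y\in M$, $|x-y|<\rho_{ie}$; (3) there are $c_{vol},C_{vol},\rho_{vol}>0$ with $c_{vol}\varepsilon^d\le\mu(B_M(x,\varepsilon))\le C_{vol}\varepsilon^d$ for all $x\in M$, $0<\varepsilon<\rho_{vol}$; (4) the boundary of $M$ is regular enough that reflected Brownian motion in $M$ exists (the $\mu$-symmetric Hunt process $X=(X_t)_{t\ge0}$ with continuous paths in $M$ associated with the Dirichlet form $\frac12\int_M\nabla f\cdot\nabla g\,d\mu$ on $H^1(M)$). Notation. For compact $S\subset\mathbb R^d$, $S^r=\{x\in\mathbb R^d:\operatorname{dist}(x,S)\le r\}$. $\Gamma_T=\{X_t:0\le t\le T\}$, $R_q(T,r)=\{H_q(\Gamma_T^r)\cong H_q(M)\}$, $R(T,r)=\bigcap_{q=0}^dR_q(T,r)$. $\tau_A=\inf\{t\ge0:X_t\in A\}$. An intrinsic $\varepsilon$-net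 is a finite set $\{x_1,\dots,x_N\}\subset M$ with $M\subseteq\bigcup_iB_M(x_i,\varepsilon)$, and $N_\varepsilon(M)$ is the minimal cardinality of such a net. Certificates. For a continuous path $\gamma:[0,T]\to M$ put $\operatorname{Tr}(\gamma)=\gamma([0,T])$; $\gamma$ hits all targets of a finite family $\mathcal A=\{A_1,\dots,A_m\}$ of measurable subsets of $M$ if $\operatorname{Tr}(\gamma)\cap A_i\ne\varnothing$ for all $i$. $H_T(\mathcal A)=\bigcap_{i}\{\tau_{A_i}\le T\}$ denotes the event that $X|_{[0,T]}$ hits all targets. $\mathcal A$ is a degree-$q$, radius-$r$ homological certificate for $M$ if every continuous path $\gamma:[0,T]\to M$ (any $T$) hitting all targets of $\mathcal A$ satisfies $H_q(\operatorname{Tr}(\gamma)^r)\cong H_q(M)$; it is a full homological certificate at radius $r$ if this holds simultaneously for every $q=0,\dots,d$. *)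

theory Defs
  imports "HOL-Homology.Homology" "HOL-Probability.Probability"
begin

section \<open>Singular homology with field coefficients\<close>

text \<open>
  The library's singular homology has integer coefficients. The complex below uses its singular
  simplices and faces, and replaces the integer chains by finitely supported functions into a
  field. A type argument \<open>TYPE('k)\<close> names the coefficient field wherever it does not occur in
  the types of the other arguments.
\<close>

type_synonym ('a, 'k) fchain = "((nat \<Rightarrow> real) \<Rightarrow> 'a) \<Rightarrow>\<^sub>0 'k"

definition fchains :: "nat \<Rightarrow> 'a topology \<Rightarrow> ('a, 'k::field) fchain set" where
  "fchains p X = {c. Poly_Mapping.keys c \<subseteq> singular_simplex_set p X}"

definition fboundary :: "nat \<Rightarrow> ('a, 'k::field) fchain \<Rightarrow> ('a, 'k) fchain" where
  "fboundary p c =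
     (if p = 0 then 0
      else \<Sum>f\<in>Poly_Mapping.keys c. \<Sum>k\<le>p.
             Poly_Mapping.single (singular_face p k f) ((-1) ^ k * Poly_Mapping.lookup c f))"

definition fsmult :: "'k::field \<Rightarrow> ('a, 'k) fchain \<Rightarrow> ('a, 'k) fchain" where
  "fsmult a c = Poly_Mapping.map ((*) a) c"

definition fcycles :: "nat \<Rightarrow> 'a topology \<Rightarrow> ('a, 'k::field) fchain set" where
  "fcycles p X = {c \<in> fchains p X. fboundary p c = 0}"

definition fboundaries :: "nat \<Rightarrow> 'a topology \<Rightarrow> ('a, 'k::field) fchain set" where
  "fboundaries p X = fboundary (Suc p) ` fchains (Suc p) X"

definition fhomology_class ::
    "nat \<Rightarrow> 'a topology \<Rightarrow> ('a, 'k::field) fchain \<Rightarrow> ('a, 'k) fchain set" where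
  "fhomology_class p X z = (\<lambda>b. z + b) ` fboundaries p X"

definition fhomology :: "nat \<Rightarrow> 'a topology \<Rightarrow> ('a, 'k::field) fchain set set" where
  "fhomology p X = fhomology_class p X ` fcycles p X"

text \<open>
  Isomorphism of vector spaces. The vector space operations on classes are
  \<open>a [u] + [v] = [a u + v]\<close>, and linearity of \<open>\<phi>\<close> is stated through representatives.
\<close>

definition fhomology_iso ::
    "'k::field itself \<Rightarrow> nat \<Rightarrow> 'a topology \<Rightarrow> 'b topology \<Rightarrow> bool" where
  "fhomology_iso K p X Y \<longleftrightarrow>
     (\<exists>\<phi> :: ('a, 'k) fchain set \<Rightarrow> ('b, 'k) fchain set.
        bij_betw \<phi> (fhomology p X) (fhomology p Y) \<and>
        (\<forall>a. \<forall>u\<in>fcycles p X. \<forall>v\<in>fcycles p X. \<forall>u'\<in>fcycles p Y. \<forall>v'\<in>fcycles p Y.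
           \<phi> (fhomology_class p X u) = fhomology_class p Y u' \<longrightarrow>
           \<phi> (fhomology_class p X v) = fhomology_class p Y v' \<longrightarrow>
           \<phi> (fhomology_class p X (fsmult a u + v)) = fhomology_class p Y (fsmult a u' + v')))"


section \<open>Geometry of the domain\<close>

definition reach :: "'a::euclidean_space set \<Rightarrow> ereal" where
  "reach M = Sup {ereal t | t. t \<ge> 0 \<and>
     (\<forall>z. 0 < infdist z M \<and> infdist z M < t \<longrightarrow> (\<exists>!p. p \<in> M \<and> dist z p = infdist z M))}"

definition thickening :: "'a::euclidean_space set \<Rightarrow> real \<Rightarrow> 'a set" where
  "thickening S r = {x. infdist x S \<le> r}"

definition curve_length :: "(real \<Rightarrow> 'a::euclidean_space) \<Rightarrow> ereal" where
  "curve_length g =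
     (SUP (n, s) \<in> {(n, s :: nat \<Rightarrow> real). mono s \<and> range s \<subseteq> {0..1}}.
        \<Sum>i<n. ereal (dist (g (s i)) (g (s (Suc i)))))"

text \<open>The infimum of the empty set is \<open>\<infinity>\<close>, the distance of points not joined by a rectifiable curve.\<close>

definition intrinsic_dist ::
    "'a::euclidean_space set \<Rightarrow> 'a \<Rightarrow> 'a \<Rightarrow> ereal" where
  "intrinsic_dist M x y =
     Inf {curve_length g | g. path g \<and> path_image g \<subseteq> M \<and> pathstart g = x \<and> pathfinish g = y
            \<and> curve_length g < \<infinity>}"

definition intrinsic_ball :: "'a::euclidean_space set \<Rightarrow> 'a \<Rightarrow> real \<Rightarrow> 'a set" where
  "intrinsic_ball M x \<epsilon> = {y \<in> M. intrinsic_dist M x y < ereal \<epsilon>}"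

definition normalized_lebesgue :: "'a::euclidean_space set \<Rightarrow> 'a measure" where
  "normalized_lebesgue M = uniform_measure (lebesgue_on M) M"

definition intrinsic_net :: "'a::euclidean_space set \<Rightarrow> real \<Rightarrow> 'a set \<Rightarrow> bool" where
  "intrinsic_net M \<epsilon> N \<longleftrightarrow> finite N \<and> N \<subseteq> M \<and> M \<subseteq> (\<Union>x\<in>N. intrinsic_ball M x \<epsilon>)"

definition net_number :: "'a::euclidean_space set \<Rightarrow> real \<Rightarrow> nat" where
  "net_number M \<epsilon> = (LEAST n. \<exists>N. intrinsic_net M \<epsilon> N \<and> card N = n)"


section \<open>Homological certificates\<close>

definition hits_all :: "(real \<Rightarrow> 'a) \<Rightarrow> real \<Rightarrow> 'a set set \<Rightarrow> bool" where
  "hits_all \<gamma> T \<A> \<longleftrightarrow> (\<forall>A\<in>\<A>. \<gamma> ` {0..T} \<inter> A \<noteq> {})"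

definition target_family :: "'a::euclidean_space set \<Rightarrow> 'a set set \<Rightarrow> bool" where
  "target_family M \<A> \<longleftrightarrow> finite \<A> \<and> (\<forall>A\<in>\<A>. A \<subseteq> M \<and> A \<in> sets borel)"

definition homological_certificate ::
    "'k::field itself \<Rightarrow> 'a::euclidean_space set \<Rightarrow> nat \<Rightarrow> real \<Rightarrow> 'a set set \<Rightarrow> bool" where
  "homological_certificate K M q r \<A> \<longleftrightarrow> target_family M \<A> \<and>
     (\<forall>T \<gamma>. T \<ge> 0 \<longrightarrow> continuous_on {0..T} \<gamma> \<longrightarrow> \<gamma> ` {0..T} \<subseteq> M \<longrightarrow> hits_all \<gamma> T \<A> \<longrightarrow>
        fhomology_iso K q (top_of_set (thickening (\<gamma> ` {0..T}) r)) (top_of_set M))"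

definition full_homological_certificate ::
    "'k::field itself \<Rightarrow> 'a::euclidean_space set \<Rightarrow> real \<Rightarrow> 'a set set \<Rightarrow> bool" where
  "full_homological_certificate K M r \<A> \<longleftrightarrow> target_family M \<A> \<and>
     (\<forall>T \<gamma>. T \<ge> 0 \<longrightarrow> continuous_on {0..T} \<gamma> \<longrightarrow> \<gamma> ` {0..T} \<subseteq> M \<longrightarrow> hits_all \<gamma> T \<A> \<longrightarrow>
        (\<forall>q\<le>DIM('a).
          fhomology_iso K q (top_of_set (thickening (\<gamma> ` {0..T}) r)) (top_of_set M)))"


section \<open>Reflected Brownian motion\<close>

text \<open>A process is a map \<open>X t \<omega>\<close> on a measurable space \<open>\<Omega>\<close> (of which only the space and the
  events matter), together with laws \<open>P x\<close> on \<open>\<Omega>\<close>, one for each starting point \<open>x \<in> M\<close>.\<close>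

definition natural_events :: "'w measure \<Rightarrow> (real \<Rightarrow> 'w \<Rightarrow> 'a::topological_space) \<Rightarrow> real \<Rightarrow> 'w set set" where
  "natural_events \<Omega> X t =
     sigma_sets (space \<Omega>) {X u -` E \<inter> space \<Omega> | u E. 0 \<le> u \<and> u \<le> t \<and> E \<in> sets borel}"

definition right_events :: "'w measure \<Rightarrow> (real \<Rightarrow> 'w \<Rightarrow> 'a::topological_space) \<Rightarrow> real \<Rightarrow> 'w set set" where
  "right_events \<Omega> X t = (\<Inter>s\<in>{t<..}. natural_events \<Omega> X s)"

definition is_stopping_time ::
    "'w measure \<Rightarrow> (real \<Rightarrow> 'w \<Rightarrow> 'a::topological_space) \<Rightarrow> ('w \<Rightarrow> ennreal) \<Rightarrow> bool" where
  "is_stopping_time \<Omega> X \<sigma> \<longleftrightarrow>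
     (\<forall>t\<ge>0. {\<omega>\<in>space \<Omega>. \<sigma> \<omega> \<le> ennreal t} \<in> right_events \<Omega> X t)"

definition stopped_events ::
    "'w measure \<Rightarrow> (real \<Rightarrow> 'w \<Rightarrow> 'a::topological_space) \<Rightarrow> ('w \<Rightarrow> ennreal) \<Rightarrow> 'w set set" where
  "stopped_events \<Omega> X \<sigma> =
     {\<Lambda> \<in> sets \<Omega>. \<forall>t\<ge>0. \<Lambda> \<inter> {\<omega>\<in>space \<Omega>. \<sigma> \<omega> \<le> ennreal t} \<in> right_events \<Omega> X t}"

text \<open>
  Hunt processes with state space \<open>M\<close>, continuous paths and infinite lifetime. Quasi-left-continuity
  is automatic for continuous paths. The strong Markov property is required for the right-continuous
  natural filtration, which is contained in every admissible filtration.
\<close>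

definition continuous_hunt_process ::
    "'a::euclidean_space set \<Rightarrow> 'w measure \<Rightarrow> ('a \<Rightarrow> 'w measure) \<Rightarrow> (real \<Rightarrow> 'w \<Rightarrow> 'a) \<Rightarrow> bool" where
  "continuous_hunt_process M \<Omega> P X \<longleftrightarrow>
     (\<forall>t\<ge>0. X t \<in> borel_measurable \<Omega>) \<and>
     (\<forall>\<omega>\<in>space \<Omega>. continuous_on {0..} (\<lambda>t. X t \<omega>) \<and> (\<forall>t\<ge>0. X t \<omega> \<in> M)) \<and>
     (\<forall>x\<in>M. prob_space (P x) \<and> sets (P x) = sets \<Omega> \<and> (AE \<omega> in P x. X 0 \<omega> = x)) \<and>
     (\<forall>t\<ge>0. \<forall>E\<in>sets borel.
        (\<lambda>x. measure (P x) {\<omega>\<in>space \<Omega>. X t \<omega> \<in> E}) \<in> borel_measurable (restrict_space borel M)) \<and>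
     (\<forall>x\<in>M. \<forall>\<sigma>. is_stopping_time \<Omega> X \<sigma> \<longrightarrow>
        (\<forall>\<Lambda>\<in>stopped_events \<Omega> X \<sigma>. \<forall>s\<ge>0. \<forall>E\<in>sets borel.
           measure (P x) {\<omega>\<in>\<Lambda>. \<sigma> \<omega> < \<infinity> \<and> X (enn2real (\<sigma> \<omega>) + s) \<omega> \<in> E} =
           (LINT \<omega>:{\<omega>\<in>\<Lambda>. \<sigma> \<omega> < \<infinity>}|P x.
              measure (P (X (enn2real (\<sigma> \<omega>)) \<omega>)) {\<eta>\<in>space \<Omega>. X s \<eta> \<in> E})))"

definition transition ::
    "('a \<Rightarrow> 'w measure) \<Rightarrow> (real \<Rightarrow> 'w \<Rightarrow> 'a) \<Rightarrow> real \<Rightarrow> ('a \<Rightarrow> real) \<Rightarrow> 'a \<Rightarrow> real" where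
  "transition P X t f x = (LINT \<omega>|P x. f (X t \<omega>))"

definition resolvent ::
    "('a \<Rightarrow> 'w measure) \<Rightarrow> (real \<Rightarrow> 'w \<Rightarrow> 'a) \<Rightarrow> real \<Rightarrow> ('a \<Rightarrow> real) \<Rightarrow> 'a \<Rightarrow> real" where
  "resolvent P X \<alpha> f x = (LINT t:{0..}|lborel. exp (- \<alpha> * t) * transition P X t f x)"

definition bounded_borel :: "('a::euclidean_space \<Rightarrow> real) \<Rightarrow> bool" where
  "bounded_borel f \<longleftrightarrow> f \<in> borel_measurable borel \<and> bounded (range f)"

definition symmetric_process ::
    "'a::euclidean_space set \<Rightarrow> ('a \<Rightarrow> 'w measure) \<Rightarrow> (real \<Rightarrow> 'w \<Rightarrow> 'a) \<Rightarrow> bool" where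
  "symmetric_process M P X \<longleftrightarrow>
     (\<forall>t\<ge>0. \<forall>f g. bounded_borel f \<longrightarrow> bounded_borel g \<longrightarrow>
        (LINT x|normalized_lebesgue M. transition P X t f x * g x) =
        (LINT x|normalized_lebesgue M. f x * transition P X t g x))"

primrec differentiable_times :: "nat \<Rightarrow> ('a::euclidean_space \<Rightarrow> real) \<Rightarrow> bool" where
  "differentiable_times 0 f \<longleftrightarrow> continuous_on UNIV f"
| "differentiable_times (Suc k) f \<longleftrightarrow>
     (\<forall>x. f differentiable (at x)) \<and>
     (\<forall>b\<in>Basis. differentiable_times k (\<lambda>x. frechet_derivative f (at x) b))"

definition test_function :: "'a::euclidean_space set \<Rightarrow> ('a \<Rightarrow> real) \<Rightarrow> bool" where
  "test_function U \<phi> \<longleftrightarrow>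
     (\<forall>k. differentiable_times k \<phi>) \<and> (\<exists>K. compact K \<and> K \<subseteq> U \<and> (\<forall>x. x \<notin> K \<longrightarrow> \<phi> x = 0))"

text \<open>
  \<open>sobolev_H1 M f G\<close> says that \<open>f\<close> belongs to \<open>H\<^sup>1(M)\<close> and that \<open>G\<close> is its weak gradient.
  The gradient is determined only on the interior of \<open>M\<close>, so its norm and the Dirichlet form are
  integrated there (the boundary of a set of positive reach is a null set).
\<close>

definition sobolev_H1 ::
    "'a::euclidean_space set \<Rightarrow> ('a \<Rightarrow> real) \<Rightarrow> ('a \<Rightarrow> 'a) \<Rightarrow> bool" where
  "sobolev_H1 M f G \<longleftrightarrow>
     f \<in> borel_measurable (normalized_lebesgue M) \<and>
     integrable (normalized_lebesgue M) (\<lambda>x. (f x)\<^sup>2) \<and>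
     G \<in> borel_measurable (normalized_lebesgue M) \<and>
     set_integrable (normalized_lebesgue M) (interior M) (\<lambda>x. (norm (G x))\<^sup>2) \<and>
     (\<forall>\<phi>. test_function (interior M) \<phi> \<longrightarrow> (\<forall>b\<in>Basis.
        (LINT x:interior M|lebesgue. f x * frechet_derivative \<phi> (at x) b) =
        - (LINT x:interior M|lebesgue. (G x \<bullet> b) * \<phi> x)))"

text \<open>
  The process is associated with the Dirichlet form \<open>\<E>(f, g) = 1/2 \<integral> \<nabla>f \<bullet> \<nabla>g d\<mu>\<close> on \<open>H\<^sup>1(M)\<close> if
  its resolvent is the resolvent of the form: \<open>R\<^sub>\<alpha> f \<in> H\<^sup>1(M)\<close> and
  \<open>\<E>(R\<^sub>\<alpha> f, g) + \<alpha> \<langle>R\<^sub>\<alpha> f, g\<rangle> = \<langle>f, g\<rangle>\<close> for all \<open>g \<in> H\<^sup>1(M)\<close>. Bounded Borel functions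
  are dense in \<open>L\<^sup>2(\<mu>)\<close>.
\<close>

definition reflected_brownian_motion ::
    "'a::euclidean_space set \<Rightarrow> 'w measure \<Rightarrow> ('a \<Rightarrow> 'w measure) \<Rightarrow> (real \<Rightarrow> 'w \<Rightarrow> 'a) \<Rightarrow> bool" where
  "reflected_brownian_motion M \<Omega> P X \<longleftrightarrow>
     continuous_hunt_process M \<Omega> P X \<and> symmetric_process M P X \<and>
     (\<forall>\<alpha>>0. \<forall>f. bounded_borel f \<longrightarrow>
        (\<exists>G. sobolev_H1 M (resolvent P X \<alpha> f) G \<and>
           (\<forall>g H. sobolev_H1 M g H \<longrightarrow>
              1/2 * (LINT x:interior M|normalized_lebesgue M. G x \<bullet> H x)
              + \<alpha> * (LINT x|normalized_lebesgue M. resolvent P X \<alpha> f x * g x)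
              = (LINT x|normalized_lebesgue M. f x * g x))))"


section \<open>Events\<close>

definition hit_event :: "'w measure \<Rightarrow> (real \<Rightarrow> 'w \<Rightarrow> 'a) \<Rightarrow> real \<Rightarrow> 'a set set \<Rightarrow> 'w set" where
  "hit_event \<Omega> X T \<A> = {\<omega>\<in>space \<Omega>. hits_all (\<lambda>t. X t \<omega>) T \<A>}"

definition recovery_event ::
    "'k::field itself \<Rightarrow> 'w measure \<Rightarrow> (real \<Rightarrow> 'w \<Rightarrow> 'a::euclidean_space) \<Rightarrow> 'a set
       \<Rightarrow> nat \<Rightarrow> real \<Rightarrow> real \<Rightarrow> 'w set" where
  "recovery_event K \<Omega> X M q T r =
     {\<omega>\<in>space \<Omega>. fhomology_iso K q
        (top_of_set (thickening ((\<lambda>t. X t \<omega>) ` {0..T}) r)) (top_of_set M)}"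

definition full_recovery_event ::
    "'k::field itself \<Rightarrow> 'w measure \<Rightarrow> (real \<Rightarrow> 'w \<Rightarrow> 'a::euclidean_space) \<Rightarrow> 'a set
       \<Rightarrow> real \<Rightarrow> real \<Rightarrow> 'w set" where
  "full_recovery_event K \<Omega> X M T r = (\<Inter>q\<in>{0..DIM('a)}. recovery_event K \<Omega> X M q T r)"

definition hitting_time :: "(real \<Rightarrow> 'w \<Rightarrow> 'a) \<Rightarrow> 'a set \<Rightarrow> 'w \<Rightarrow> ereal" where
  "hitting_time X A \<omega> = Inf {ereal t | t. t \<ge> 0 \<and> X t \<omega> \<in> A}"

text \<open>
  \<open>hit_event\<close> is the event that the path on \<open>[0, T]\<close> meets every target. It differs from the set
  where all hitting times are at most \<open>T\<close> only where a hitting time equals \<open>T\<close> and is not attained,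
  which does not happen for closed targets.
\<close>

lemma hit_event_hitting_time:
  "{\<omega>\<in>space \<Omega>. \<forall>A\<in>\<A>. hitting_time X A \<omega> < ereal T} \<subseteq> hit_event \<Omega> X T \<A>"
  "hit_event \<Omega> X T \<A> \<subseteq> {\<omega>\<in>space \<Omega>. \<forall>A\<in>\<A>. hitting_time X A \<omega> \<le> ereal T}"
proof -
  show "{\<omega>\<in>space \<Omega>. \<forall>A\<in>\<A>. hitting_time X A \<omega> < ereal T} \<subseteq> hit_event \<Omega> X T \<A>"
    by (fastforce simp: hit_event_def hits_all_def hitting_time_def Inf_less_iff)
  show "hit_event \<Omega> X T \<A> \<subseteq> {\<omega>\<in>space \<Omega>. \<forall>A\<in>\<A>. hitting_time X A \<omega> \<le> ereal T}"
  proof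
    fix \<omega> assume \<omega>: "\<omega> \<in> hit_event \<Omega> X T \<A>"
    have "hitting_time X A \<omega> \<le> ereal T" if "A \<in> \<A>" for A
    proof -
      obtain t where t: "0 \<le> t" "t \<le> T" "X t \<omega> \<in> A"
        using \<omega> \<open>A \<in> \<A>\<close> by (fastforce simp: hit_event_def hits_all_def)
      have "hitting_time X A \<omega> \<le> ereal t"
        unfolding hitting_time_def using t by (intro Inf_lower) auto
      then show ?thesis using t(2) by (meson ereal_less_eq(3) order_trans)
    qed
    then show "\<omega> \<in> {\<omega>\<in>space \<Omega>. \<forall>A\<in>\<A>. hitting_time X A \<omega> \<le> ereal T}"
      using \<omega> by (auto simp: hit_event_def)
  qed
qed

lemma hit_event_closed_targets:
  fixes X :: "real \<Rightarrow> 'w \<Rightarrow> 'a::topological_space"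
  assumes "\<And>\<omega>. \<omega> \<in> space \<Omega> \<Longrightarrow> continuous_on {0..} (\<lambda>t. X t \<omega>)" and "\<And>A. A \<in> \<A> \<Longrightarrow> closed A"
  shows "hit_event \<Omega> X T \<A> = {\<omega>\<in>space \<Omega>. \<forall>A\<in>\<A>. hitting_time X A \<omega> \<le> ereal T}"
proof
  show "{\<omega>\<in>space \<Omega>. \<forall>A\<in>\<A>. hitting_time X A \<omega> \<le> ereal T} \<subseteq> hit_event \<Omega> X T \<A>"
  proof
    fix \<omega> assume \<omega>: "\<omega> \<in> {\<omega>\<in>space \<Omega>. \<forall>A\<in>\<A>. hitting_time X A \<omega> \<le> ereal T}"
    have "(\<lambda>t. X t \<omega>) ` {0..T} \<inter> A \<noteq> {}" if A: "A \<in> \<A>" for A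
    proof -
      define S where "S = {t. t \<ge> 0 \<and> X t \<omega> \<in> A}"
      have "S = (\<lambda>t. X t \<omega>) -` A \<inter> {0..}" by (auto simp: S_def)
      with continuous_closed_preimage[OF assms(1) closed_atLeast assms(2)[OF A]] \<omega>
      have "closed S" by (simp add: Int_commute)
      have le: "Inf (ereal ` S) \<le> ereal T"
        using \<omega> A by (auto simp: hitting_time_def S_def setcompr_eq_image)
      have "S \<noteq> {}" using le by (auto simp: top_ereal_def)
      have bdd: "bdd_below S" by (auto simp: S_def intro!: bdd_belowI[of _ 0])
      have "Inf S \<in> S" using closed_contains_Inf[OF \<open>S \<noteq> {}\<close> bdd \<open>closed S\<close>] .
      moreover have "ereal (Inf S) \<le> Inf (ereal ` S)"
        using bdd by (auto intro!: INF_greatest cInf_lower)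
      ultimately have "Inf S \<ge> 0" "X (Inf S) \<omega> \<in> A" "Inf S \<le> T"
        using le by (auto simp: S_def dest: order_trans)
      then show ?thesis by (auto intro!: image_eqI[of _ _ "Inf S"])
    qed
    then show "\<omega> \<in> hit_event \<Omega> X T \<A>" using \<omega> by (auto simp: hit_event_def hits_all_def)
  qed
qed (rule hit_event_hitting_time(2))

end

theory Submission
  imports Defs
begin

text \<open>
  Part (i) is the definition of a certificate, applied to the sample paths of the process: they are
  continuous and stay in \<open>M\<close>.

  For part (ii), let \<open>S\<close> be the trace of a path that meets every ball of an \<open>\<epsilon>\<close>-net. Intrinsic distances
  dominate Euclidean ones, so every point of \<open>M\<close> is within \<open>\<delta> = 2 \<epsilon>\<close> of \<open>S\<close>. It suffices that, for
  \<open>2 \<delta> \<le> r\<close> and \<open>4 r\<close> less than the reach, the thickening \<open>S\<^sup>r\<close> deformation retracts to \<open>M\<close>. The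
  retraction is the nearest-point projection \<open>\<pi>\<close>, and the homotopy is the straight line from \<open>x\<close> to
  \<open>\<pi> x\<close>. What has to be seen is that this segment stays in \<open>S\<^sup>r\<close>
  (\<open>segment_to_nearest_in_thickening\<close>). Near \<open>\<pi> x\<close> this follows from density. Near \<open>x\<close>, the distance
  to the point \<open>s\<close> of \<open>S\<close> nearest to \<open>x\<close> does not grow along the way, because Federer's inequality
  (\<open>nearest_inner_le\<close>) bounds \<open>(x - \<pi> x) \<bullet> (s - \<pi> x)\<close> by a multiple of \<open>|s - \<pi> x|\<^sup>2\<close>. The inequality
  rests on the fact that \<open>\<pi>\<close> is constant along the ray from \<open>\<pi> x\<close> through \<open>x\<close> up to the reach
  (\<open>nearest_ray_extends\<close>), for which Brouwer's fixed point theorem gives a short proof that covers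
  finite and infinite reach alike.

  To pass from the deformation retraction to homology with coefficients in a field \<open>K\<close>, homotopy
  invariance is needed for the complex over \<open>K\<close>. A chain homotopy is determined by chains in the
  prisms \<open>[0, 1] \<times> \<Delta>\<^sup>q\<close> with prescribed boundary. They exist over the integers by acyclicity of the prism
  (\<open>prisms_exist\<close>), and their images over \<open>K\<close> give the homotopy there
  (\<open>fchain_map_homotopic\<close>).

  The targets must be Borel sets, and a minimal net must exist and have pairwise different balls. The first
  two follow since intrinsic balls are relatively open in \<open>M\<close>, which uses the comparison of intrinsic
  and Euclidean distance at small scale, and the last from minimality.
\<close>

section \<open>Chains with field coefficients\<close>

lemma lookup_fsmult [simp]: "Poly_Mapping.lookup (fsmult a c) x = a * Poly_Mapping.lookup c x"
  unfolding fsmult_def by transfer (simp add: when_def)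

lemma keys_fsmult: "Poly_Mapping.keys (fsmult a c) \<subseteq> Poly_Mapping.keys c"
  by (auto simp: in_keys_iff)

lemma fsmult_add_right: "fsmult a (b + c) = fsmult a b + fsmult a c"
  by (rule poly_mapping_eqI) (simp add: lookup_add algebra_simps)

lemma fsmult_diff_right: "fsmult a (b - c) = fsmult a b - fsmult a c"
  by (rule poly_mapping_eqI) (simp add: lookup_minus algebra_simps)

lemma fsmult_0_right [simp]: "fsmult a 0 = 0"
  by (rule poly_mapping_eqI) simp

lemma fsmult_0_left [simp]: "fsmult 0 c = 0"
  by (rule poly_mapping_eqI) simp

lemma fsmult_fsmult [simp]: "fsmult a (fsmult b c) = fsmult (a * b) c"
  by (rule poly_mapping_eqI) simp

lemma fsmult_add_left: "fsmult (a + b) c = fsmult a c + fsmult b c"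
  by (rule poly_mapping_eqI) (simp add: lookup_add algebra_simps)

lemma fsmult_single [simp]: "fsmult a (Poly_Mapping.single x b) = Poly_Mapping.single x (a * b)"
  by (rule poly_mapping_eqI) (simp add: lookup_single when_def)

lemma fsmult_sum: "fsmult a (sum f I) = (\<Sum>i\<in>I. fsmult a (f i))"
  by (induction I rule: infinite_finite_induct) (auto simp: fsmult_add_right)

definition fextend ::
    "(((nat \<Rightarrow> real) \<Rightarrow> 'a) \<Rightarrow> ('b, 'k) fchain) \<Rightarrow> ('a, 'k::field) fchain \<Rightarrow> ('b, 'k) fchain" where
  "fextend F c = (\<Sum>\<sigma>\<in>Poly_Mapping.keys c. fsmult (Poly_Mapping.lookup c \<sigma>) (F \<sigma>))"

lemma fextend_superset:
  assumes "finite S" "Poly_Mapping.keys c \<subseteq> S"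
  shows "fextend F c = (\<Sum>\<sigma>\<in>S. fsmult (Poly_Mapping.lookup c \<sigma>) (F \<sigma>))"
  unfolding fextend_def using assms by (intro sum.mono_neutral_left) (auto simp: in_keys_iff)

lemma fextend_0 [simp]: "fextend F 0 = 0"
  by (simp add: fextend_def)

lemma fextend_single [simp]: "fextend F (Poly_Mapping.single \<sigma> a) = fsmult a (F \<sigma>)"
  by (subst fextend_superset[where S="{\<sigma>}"]) auto

lemma fextend_add: "fextend F (a + b) = fextend F a + fextend F b"
proof -
  let ?S = "Poly_Mapping.keys a \<union> Poly_Mapping.keys b"
  have "Poly_Mapping.keys (a + b) \<subseteq> ?S" by (rule keys_add)
  then show ?thesis
    by (simp add: fextend_superset[where S="?S"] lookup_add fsmult_add_left sum.distrib)
qed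

lemma fextend_fsmult: "fextend F (fsmult a c) = fsmult a (fextend F c)"
  by (simp add: fextend_superset[where S="Poly_Mapping.keys c"] keys_fsmult fsmult_sum)

lemma fextend_uminus: "fextend F (- c) = - fextend F c"
  using fextend_add[of F c "- c"] by (simp add: eq_neg_iff_add_eq_0 add.commute)

lemma fextend_diff: "fextend F (a - b) = fextend F a - fextend F b"
  using fextend_add[of F a "- b"] by (simp add: fextend_uminus)

lemma keys_fextend:
  assumes "\<And>\<sigma>. \<sigma> \<in> Poly_Mapping.keys c \<Longrightarrow> Poly_Mapping.keys (F \<sigma>) \<subseteq> T"
  shows "Poly_Mapping.keys (fextend F c) \<subseteq> T"
  unfolding fextend_def using keys_fsmult assms
  by (intro order_trans[OF keys_sum]) blast

text \<open>
  Change of coefficients along \<open>\<int> \<rightarrow> K\<close>. It commutes with boundaries, induced maps and linear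
  extension, so an identity between natural operators on chains need only be checked on a single
  simplex, and there it may be imported from the integers. This is the purpose of
  \<open>fchain_induct\<close>, whose generators are written as images of integral simplices.
\<close>

definition of_int_chain :: "'a chain \<Rightarrow> ('a, 'k::field) fchain" where
  "of_int_chain c = Poly_Mapping.map of_int c"

lemma lookup_of_int_chain [simp]:
  "Poly_Mapping.lookup (of_int_chain c) x = of_int (Poly_Mapping.lookup c x)"
  unfolding of_int_chain_def by transfer (simp add: when_def)

lemma of_int_chain_add: "of_int_chain (a + b) = of_int_chain a + of_int_chain b"
  by (rule poly_mapping_eqI) (simp add: lookup_add)

lemma of_int_chain_diff: "of_int_chain (a - b) = of_int_chain a - of_int_chain b"
  by (rule poly_mapping_eqI) (simp add: lookup_minus)

lemma of_int_chain_0 [simp]: "of_int_chain 0 = 0"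
  by (rule poly_mapping_eqI) simp

lemma of_int_chain_frag_cmul: "of_int_chain (frag_cmul k c) = fsmult (of_int k) (of_int_chain c)"
  by (rule poly_mapping_eqI) simp

lemma of_int_chain_frag_of [simp]: "of_int_chain (frag_of x) = Poly_Mapping.single x 1"
  by (rule poly_mapping_eqI) (simp add: lookup_single when_def)

lemma of_int_chain_sum: "of_int_chain (sum f I) = (\<Sum>i\<in>I. of_int_chain (f i))"
  by (induction I rule: infinite_finite_induct) (auto simp: of_int_chain_add)

lemma keys_of_int_chain: "Poly_Mapping.keys (of_int_chain c) \<subseteq> Poly_Mapping.keys c"
  by (auto simp: in_keys_iff)

lemma of_int_chain_in_fchains: "singular_chain p X c \<Longrightarrow> of_int_chain c \<in> fchains p X"
  using keys_of_int_chain[of c] by (auto simp: singular_chain_def fchains_def)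

lemma of_int_chain_frag_extend:
  "of_int_chain (frag_extend F c) = fextend (\<lambda>\<sigma>. of_int_chain (F \<sigma>)) (of_int_chain c)"
  by (simp add: frag_extend_def of_int_chain_sum of_int_chain_frag_cmul
      fextend_superset[where S="Poly_Mapping.keys c"] keys_of_int_chain)

lemma fchain_induct [consumes 1, case_names zero simplex add]:
  fixes c :: "('a, 'k::field) fchain"
  assumes "c \<in> fchains p X"
    and zero: "Q 0"
    and simplex: "\<And>\<sigma> a. singular_simplex p X \<sigma> \<Longrightarrow> Q (fsmult a (of_int_chain (frag_of \<sigma>)))"
    and add: "\<And>a b. Q a \<Longrightarrow> Q b \<Longrightarrow> Q (a + b)"
  shows "Q c"
proof -
  have "Q (\<Sum>\<sigma>\<in>S. Poly_Mapping.single \<sigma> (Poly_Mapping.lookup c \<sigma>))"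
    if "finite S" "S \<subseteq> Poly_Mapping.keys c" for S
    using that
  proof induction
    case (insert \<sigma> S)
    have "singular_simplex p X \<sigma>"
      using insert.prems assms(1) by (auto simp: fchains_def)
    from simplex[OF this, of "Poly_Mapping.lookup c \<sigma>"] insert show ?case
      by (auto intro: add)
  qed (auto intro: zero)
  moreover have "(\<Sum>\<sigma>\<in>Poly_Mapping.keys c. Poly_Mapping.single \<sigma> (Poly_Mapping.lookup c \<sigma>)) = c"
    by (rule poly_mapping_eqI)
      (simp add: lookup_sum lookup_single when_def in_keys_iff if_distrib[where f="\<lambda>f. f x" for x] sum.delta cong: if_cong)
  ultimately show ?thesis
    using finite_keys order_refl by metis
qed

definition fchain_map :: "nat \<Rightarrow> ('a \<Rightarrow> 'b) \<Rightarrow> ('a, 'k::field) fchain \<Rightarrow> ('b, 'k) fchain" where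
  "fchain_map p g = fextend (\<lambda>\<sigma>. Poly_Mapping.single (simplex_map p g \<sigma>) 1)"

lemma fboundary_fextend:
  "fboundary p = fextend (\<lambda>\<sigma>. of_int_chain (chain_boundary p (frag_of \<sigma>)))"
proof
  fix c :: "('a, 'k::field) fchain"
  show "fboundary p c = fextend (\<lambda>\<sigma>. of_int_chain (chain_boundary p (frag_of \<sigma>))) c"
    by (simp add: fboundary_def fextend_def chain_boundary_of of_int_chain_sum
        of_int_chain_frag_cmul fsmult_sum mult.commute)
qed

lemma fboundary_linear:
  "fboundary p (a + b) = fboundary p a + fboundary p b"
  "fboundary p (a - b) = fboundary p a - fboundary p b"
  "fboundary p (fsmult x a) = fsmult x (fboundary p a)"
  "fboundary p 0 = 0"
  by (simp_all add: fboundary_fextend fextend_add fextend_diff fextend_fsmult)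

lemma fchain_map_linear:
  "fchain_map p g (a + b) = fchain_map p g a + fchain_map p g b"
  "fchain_map p g (a - b) = fchain_map p g a - fchain_map p g b"
  "fchain_map p g (fsmult x a) = fsmult x (fchain_map p g a)"
  "fchain_map p g 0 = 0"
  by (simp_all add: fchain_map_def fextend_add fextend_diff fextend_fsmult)

lemma fboundary_of_int_chain: "fboundary p (of_int_chain c) = of_int_chain (chain_boundary p c)"
proof (cases "p = 0")
  case False
  then have "chain_boundary p c = frag_extend (\<lambda>\<sigma>. chain_boundary p (frag_of \<sigma>)) c"
    by (simp add: chain_boundary_def)
  then show ?thesis
    by (simp add: of_int_chain_frag_extend fboundary_fextend)
qed (simp_all add: fboundary_def chain_boundary_def)

lemma fchain_map_of_int_chain: "fchain_map p g (of_int_chain c) = of_int_chain (chain_map p g c)"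
  by (simp add: fchain_map_def chain_map_def of_int_chain_frag_extend)

lemma fchains_add: "a \<in> fchains p X \<Longrightarrow> b \<in> fchains p X \<Longrightarrow> a + b \<in> fchains p X"
  unfolding fchains_def using keys_add[of a b] by blast

lemma fchains_diff: "a \<in> fchains p X \<Longrightarrow> b \<in> fchains p X \<Longrightarrow> a - b \<in> fchains p X"
  unfolding fchains_def using keys_diff[of a b] by blast

lemma fchains_fsmult: "c \<in> fchains p X \<Longrightarrow> fsmult a c \<in> fchains p X"
  unfolding fchains_def using keys_fsmult[of a c] by blast

lemma fchains_0: "0 \<in> fchains p X"
  by (simp add: fchains_def)

lemma fchain_map_in_fchains:
  fixes c :: "('a, 'k::field) fchain"
  assumes "c \<in> fchains p X" "continuous_map X Y g"
  shows "fchain_map p g c \<in> fchains p Y"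
proof -
  have "Poly_Mapping.keys (fchain_map p g c) \<subseteq> singular_simplex_set p Y"
    unfolding fchain_map_def
  proof (rule keys_fextend)
    fix \<sigma> assume "\<sigma> \<in> Poly_Mapping.keys c"
    then show "Poly_Mapping.keys (Poly_Mapping.single (simplex_map p g \<sigma>) (1::'k)) \<subseteq> singular_simplex_set p Y"
      using assms singular_simplex_simplex_map[of p X \<sigma> Y g] by (auto simp: fchains_def)
  qed
  then show ?thesis by (simp add: fchains_def)
qed

lemma fboundary_fchain_map:
  assumes "c \<in> fchains p X"
  shows "fboundary p (fchain_map p g c) = fchain_map (p - 1) g (fboundary p c)"
  using assms
proof (induction rule: fchain_induct)
  case (simplex \<sigma> a)
  then show ?case
    by (simp only: fchain_map_linear fboundary_linear fchain_map_of_int_chain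
        fboundary_of_int_chain chain_boundary_chain_map[of p X "frag_of \<sigma>"] singular_chain_of
        One_nat_def)
qed (simp_all add: fchain_map_linear fboundary_linear)

lemma fchain_map_eq_id:
  assumes "c \<in> fchains p X" "\<And>x. x \<in> topspace X \<Longrightarrow> g x = x"
  shows "fchain_map p g c = c"
  using assms(1)
proof (induction rule: fchain_induct)
  case (simplex \<sigma> a)
  have "simplex_map p g \<sigma> = \<sigma>"
    using simplex_map_id_gen[OF simplex assms(2)] .
  then show ?case
    by (simp add: fchain_map_def)
qed (simp_all add: fchain_map_linear)

lemma fboundaries_iff: "b \<in> fboundaries p X \<longleftrightarrow> (\<exists>d\<in>fchains (Suc p) X. b = fboundary (Suc p) d)"
  by (auto simp: fboundaries_def)

lemma fboundaries_0: "0 \<in> fboundaries p X"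
  unfolding fboundaries_iff using fchains_0 fboundary_linear(4) by metis

lemma fboundaries_add: "a \<in> fboundaries p X \<Longrightarrow> b \<in> fboundaries p X \<Longrightarrow> a + b \<in> fboundaries p X"
  unfolding fboundaries_iff using fchains_add fboundary_linear(1) by metis

lemma fboundaries_diff: "a \<in> fboundaries p X \<Longrightarrow> b \<in> fboundaries p X \<Longrightarrow> a - b \<in> fboundaries p X"
  unfolding fboundaries_iff using fchains_diff fboundary_linear(2) by metis

lemma fboundaries_fsmult: "b \<in> fboundaries p X \<Longrightarrow> fsmult a b \<in> fboundaries p X"
  unfolding fboundaries_iff using fchains_fsmult fboundary_linear(3) by metis

lemma fcycles_add: "a \<in> fcycles p X \<Longrightarrow> b \<in> fcycles p X \<Longrightarrow> a + b \<in> fcycles p X"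
  by (simp add: fcycles_def fchains_add fboundary_linear)

lemma fcycles_diff: "a \<in> fcycles p X \<Longrightarrow> b \<in> fcycles p X \<Longrightarrow> a - b \<in> fcycles p X"
  by (simp add: fcycles_def fchains_diff fboundary_linear)

lemma fcycles_fsmult: "c \<in> fcycles p X \<Longrightarrow> fsmult a c \<in> fcycles p X"
  by (simp add: fcycles_def fchains_fsmult fboundary_linear)

lemma fchain_map_fcycles:
  assumes "c \<in> fcycles p X" "continuous_map X Y g"
  shows "fchain_map p g c \<in> fcycles p Y"
proof -
  have "c \<in> fchains p X" "fboundary p c = 0"
    using assms(1) by (simp_all add: fcycles_def)
  then show ?thesis
    using fchain_map_in_fchains[OF _ assms(2)] by (simp add: fcycles_def fboundary_fchain_map fchain_map_linear)
qed

lemma fchain_map_fboundaries: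
  assumes "b \<in> fboundaries p X" "continuous_map X Y g"
  shows "fchain_map p g b \<in> fboundaries p Y"
proof -
  obtain d where d: "d \<in> fchains (Suc p) X" "b = fboundary (Suc p) d"
    using assms(1) by (auto simp: fboundaries_iff)
  then have "fchain_map p g b = fboundary (Suc p) (fchain_map (Suc p) g d)"
    by (simp add: fboundary_fchain_map)
  then show ?thesis
    using fchain_map_in_fchains[OF d(1) assms(2)] by (auto simp: fboundaries_iff)
qed

lemma fhomology_class_eq_iff:
  fixes u v :: "('a, 'k::field) fchain"
  shows "fhomology_class p X u = fhomology_class p X v \<longleftrightarrow> u - v \<in> fboundaries p X"
proof
  assume "fhomology_class p X u = fhomology_class p X v"
  moreover have "u \<in> fhomology_class p X u"
    using fboundaries_0 by (force simp: fhomology_class_def)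
  ultimately show "u - v \<in> fboundaries p X"
    by (auto simp: fhomology_class_def)
next
  have sub: "fhomology_class p X u \<subseteq> fhomology_class p X v" if "u - v \<in> fboundaries p X" for u v :: "('a, 'k) fchain"
  proof
    fix w assume "w \<in> fhomology_class p X u"
    then obtain b where b: "b \<in> fboundaries p X" "w = u + b"
      by (auto simp: fhomology_class_def)
    then have "w = v + ((u - v) + b)" by simp
    then show "w \<in> fhomology_class p X v"
      using fboundaries_add[OF that b(1)] unfolding fhomology_class_def by blast
  qed
  assume "u - v \<in> fboundaries p X"
  moreover have "v - u \<in> fboundaries p X"
    using fboundaries_diff[OF fboundaries_0 calculation] by simp
  ultimately show "fhomology_class p X u = fhomology_class p X v"
    using sub by blast
qed

text \<open>
  An isomorphism of quotients can be given on representatives: \<open>F\<close> is linear on cycles and the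
  preimage of the boundaries is exactly the boundaries, so \<open>[u] \<mapsto> [F u]\<close> is well defined and
  injective.
\<close>

lemma fhomology_iso_induced:
  fixes F :: "('a, 'k::field) fchain \<Rightarrow> ('b, 'k) fchain"
  assumes cyc: "\<And>u. u \<in> fcycles p X \<Longrightarrow> F u \<in> fcycles p Y"
    and lin: "\<And>a u v. u \<in> fcycles p X \<Longrightarrow> v \<in> fcycles p X \<Longrightarrow> F (fsmult a u + v) = fsmult a (F u) + F v"
    and inj: "\<And>u. u \<in> fcycles p X \<Longrightarrow> F u \<in> fboundaries p Y \<longleftrightarrow> u \<in> fboundaries p X"
    and surj: "\<And>v. v \<in> fcycles p Y \<Longrightarrow> \<exists>u\<in>fcycles p X. v - F u \<in> fboundaries p Y"
  shows "fhomology_iso TYPE('k) p X Y"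
proof -
  define \<phi> where "\<phi> C = fhomology_class p Y (F (SOME u. u \<in> fcycles p X \<and> fhomology_class p X u = C))" for C
  have diff: "F u - F v \<in> fboundaries p Y \<longleftrightarrow> u - v \<in> fboundaries p X"
    if uv: "u \<in> fcycles p X" "v \<in> fcycles p X" for u v
  proof -
    have "fsmult (- 1) v + u = u - v" "fsmult (- 1) (F v) + F u = F u - F v"
      by (auto intro!: poly_mapping_eqI simp: lookup_add lookup_minus)
    then show ?thesis
      using inj[OF fcycles_diff[OF uv]] lin[OF uv(2,1), of "- 1"] by simp
  qed
  have \<phi>: "\<phi> (fhomology_class p X u) = fhomology_class p Y (F u)" if u: "u \<in> fcycles p X" for u
  proof -
    let ?v = "SOME v. v \<in> fcycles p X \<and> fhomology_class p X v = fhomology_class p X u"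
    have "?v \<in> fcycles p X \<and> fhomology_class p X ?v = fhomology_class p X u"
      by (rule someI[of _ u]) (simp add: u)
    then show ?thesis
      unfolding \<phi>_def using u by (simp add: fhomology_class_eq_iff diff)
  qed
  have "bij_betw \<phi> (fhomology p X) (fhomology p Y)"
    unfolding bij_betw_def
  proof
    show "inj_on \<phi> (fhomology p X)"
      unfolding inj_on_def fhomology_def by (auto simp: \<phi> fhomology_class_eq_iff diff)
    show "\<phi> ` fhomology p X = fhomology p Y"
    proof
      show "\<phi> ` fhomology p X \<subseteq> fhomology p Y"
        by (auto simp: fhomology_def \<phi> cyc)
      show "fhomology p Y \<subseteq> \<phi> ` fhomology p X"
      proof
        fix C :: "('b, 'k) fchain set" assume "C \<in> fhomology p Y"
        then obtain v where v: "v \<in> fcycles p Y" "C = fhomology_class p Y v"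
          by (auto simp: fhomology_def)
        obtain u where u: "u \<in> fcycles p X" "v - F u \<in> fboundaries p Y"
          using surj[OF v(1)] by blast
        then have "C = \<phi> (fhomology_class p X u)"
          by (simp add: v \<phi> fhomology_class_eq_iff)
        then show "C \<in> \<phi> ` fhomology p X"
          using u(1) by (auto simp: fhomology_def)
      qed
    qed
  qed
  moreover have "\<phi> (fhomology_class p X (fsmult a u + v)) = fhomology_class p Y (fsmult a u' + v')"
    if uv: "u \<in> fcycles p X" "v \<in> fcycles p X" "u' \<in> fcycles p Y" "v' \<in> fcycles p Y"
      and eq: "\<phi> (fhomology_class p X u) = fhomology_class p Y u'"
        "\<phi> (fhomology_class p X v) = fhomology_class p Y v'" for a u v u' v'
  proof -
    have "F u - u' \<in> fboundaries p Y" "F v - v' \<in> fboundaries p Y"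
      using eq uv by (simp_all add: \<phi> fhomology_class_eq_iff)
    then have "fsmult a (F u - u') + (F v - v') \<in> fboundaries p Y"
      by (intro fboundaries_add fboundaries_fsmult)
    moreover have "fsmult a (F u - u') + (F v - v') = F (fsmult a u + v) - (fsmult a u' + v')"
      using uv by (simp add: lin fsmult_diff_right)
    ultimately show ?thesis
      using uv by (simp add: \<phi> fcycles_add fcycles_fsmult fhomology_class_eq_iff)
  qed
  ultimately show ?thesis
    unfolding fhomology_iso_def by blast
qed

section \<open>Prism chains and homotopy invariance\<close>

text \<open>
  A singular chain \<open>B\<^sub>q\<close> of degree \<open>q + 1\<close> in \<open>[0, 1] \<times> \<Delta>\<^sup>q\<close> whose boundary is top minus bottom minus
  sides induces a chain homotopy \<open>\<sigma> \<mapsto> h \<circ> (id \<times> \<sigma>)\<close> (applied to \<open>B\<^sub>q\<close>) for every homotopy \<open>h\<close>.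
  Such chains are found by acyclic models: the sides are built from \<open>B\<^bsub>q - 1\<^esub>\<close>, and the
  prescribed boundary is a cycle in a contractible space, so it bounds. No triangulation of the
  prism is written down.
\<close>

definition prism_space :: "nat \<Rightarrow> (real \<times> (nat \<Rightarrow> real)) topology" where
  "prism_space q = prod_topology (top_of_set {0..1}) (subtopology (powertop_real UNIV) (standard_simplex q))"

definition prism_end :: "nat \<Rightarrow> real \<Rightarrow> (nat \<Rightarrow> real) \<Rightarrow> real \<times> (nat \<Rightarrow> real)" where
  "prism_end q s = restrict (\<lambda>x. (s, x)) (standard_simplex q)"

definition prism_op ::
    "nat \<Rightarrow> (real \<times> (nat \<Rightarrow> real)) chain \<Rightarrow> (real \<times> 'a \<Rightarrow> 'b) \<Rightarrow> 'a chain \<Rightarrow> 'b chain" where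
  "prism_op q B h = frag_extend (\<lambda>\<sigma>. chain_map (Suc q) (\<lambda>(t, x). h (t, \<sigma> x)) B)"

text \<open>
  The sides of the prism are \<open>prism_op\<close> of the boundary of the identity simplex, for the identity
  homotopy. For \<open>q = 0\<close> that boundary is \<open>0\<close>, as a point has no sides.
\<close>

definition is_prism :: "nat \<Rightarrow> (real \<times> (nat \<Rightarrow> real)) chain \<Rightarrow> (real \<times> (nat \<Rightarrow> real)) chain \<Rightarrow> bool" where
  "is_prism q B' B \<longleftrightarrow>
     singular_chain (Suc q) (prism_space q) B \<and>
     (q > 0 \<longrightarrow> singular_chain q (prism_space (q - 1)) B') \<and>
     chain_boundary (Suc q) B =
       frag_of (prism_end q 1) - frag_of (prism_end q 0)
       - prism_op (q - 1) B' id (chain_boundary q (frag_of (restrict id (standard_simplex q))))"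

lemma topspace_prism_space: "topspace (prism_space q) = {0..1} \<times> standard_simplex q"
  by (simp add: prism_space_def)

lemma prism_op_0 [simp]: "prism_op q B h 0 = 0"
  by (simp add: prism_op_def)

lemma continuous_map_prism_simplex:
  assumes h: "continuous_map (prod_topology (top_of_set {0..1}) X) Y h" and "singular_simplex q X \<sigma>"
  shows "continuous_map (prism_space q) Y (\<lambda>(t, x). h (t, \<sigma> x))"
proof -
  have \<sigma>: "continuous_map (subtopology (powertop_real UNIV) (standard_simplex q)) X \<sigma>"
    using assms(2) by (simp add: singular_simplex_def)
  have "continuous_map (prism_space q) (prod_topology (top_of_set {0..1}) X) (\<lambda>z. (fst z, \<sigma> (snd z)))"
    unfolding prism_space_def
    using continuous_map_compose[OF continuous_map_snd \<sigma>]
    by (intro continuous_map_pairedI continuous_map_fst) (simp add: o_def)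
  from continuous_map_compose[OF this h] show ?thesis
    by (simp add: o_def case_prod_unfold)
qed

lemma singular_chain_prism_op:
  assumes h: "continuous_map (prod_topology (top_of_set {0..1}) X) Y h"
    and B: "singular_chain (Suc q) (prism_space q) B" and c: "singular_chain q X c"
  shows "singular_chain (Suc q) Y (prism_op q B h c)"
  unfolding prism_op_def
  using c by (intro singular_chain_extend singular_chain_chain_map[OF B] continuous_map_prism_simplex[OF h])
    (auto simp: singular_chain_def)

lemma chain_map_prism_end:
  "chain_map q (\<lambda>x. (s, x)) (frag_of (restrict id (standard_simplex q))) = frag_of (prism_end q s)"
  by (auto simp: simplex_map_def prism_end_def restrict_def fun_eq_iff intro!: arg_cong[where f=frag_of])

lemma simplex_map_prism_end:
  assumes "singular_simplex q X \<sigma>"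
  shows "simplex_map q (\<lambda>(t, x). h (t, \<sigma> x)) (prism_end q s) = simplex_map q (\<lambda>x. h (s, x)) \<sigma>"
  by (auto simp: simplex_map_def prism_end_def)

text \<open>
  Naturality of the prism operator in the simplex: \<open>h \<circ> (id \<times> \<sigma>) \<circ> (id \<times> \<tau>) = h \<circ> (id \<times> \<sigma> \<tau>)\<close>. It turns
  the sides of the model prism into the prism over the boundary of \<open>\<sigma>\<close>.
\<close>

lemma chain_map_prism_op:
  assumes B: "singular_chain (Suc q) (prism_space q) B"
    and c: "singular_chain q (subtopology (powertop_real UNIV) (standard_simplex r)) c"
  shows "chain_map (Suc q) (\<lambda>(t, x). h (t, \<sigma> x)) (prism_op q B id c) = prism_op q B h (chain_map q \<sigma> c)"
  using c unfolding singular_chain_def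
proof (induction c rule: frag_induction)
  case (one \<tau>)
  have "chain_map (Suc q) (\<lambda>(t, x). h (t, \<sigma> x)) (chain_map (Suc q) (\<lambda>(t, x). (t, \<tau> x)) B)
      = chain_map (Suc q) ((\<lambda>(t, x). h (t, \<sigma> x)) \<circ> (\<lambda>(t, x). (t, \<tau> x))) B"
    by (simp add: chain_map_compose)
  also have "\<dots> = chain_map (Suc q) (\<lambda>(t, x). h (t, simplex_map q \<sigma> \<tau> x)) B"
    by (rule chain_map_eq[OF B]) (auto simp: topspace_prism_space simplex_map_def)
  finally show ?case
    by (simp add: prism_op_def)
next
  case (diff a b)
  then show ?case
    by (simp add: prism_op_def chain_map_diff frag_extend_diff)
qed (simp add: prism_op_def)

text \<open>
  The homotopy formula. Both sides are additive, and on one simplex \<open>\<sigma>\<close> the formula is the image of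
  the boundary of the model prism under \<open>h \<circ> (id \<times> \<sigma>)\<close>.
\<close>

lemma chain_boundary_prism_op:
  assumes h: "continuous_map (prod_topology (top_of_set {0..1}) X) Y h"
    and B: "is_prism q B' B" and c: "singular_chain q X c"
  shows "chain_boundary (Suc q) (prism_op q B h c) =
     chain_map q (\<lambda>x. h (1, x)) c - chain_map q (\<lambda>x. h (0, x)) c - prism_op (q - 1) B' h (chain_boundary q c)"
  using c unfolding singular_chain_def
proof (induction c rule: frag_induction)
  case (one \<sigma>)
  then have \<sigma>: "singular_simplex q X \<sigma>" by simp
  let ?\<iota> = "frag_of (restrict id (standard_simplex q))"
  let ?H = "\<lambda>(t, x). h (t, \<sigma> x)"
  have \<iota>: "singular_chain q (subtopology (powertop_real UNIV) (standard_simplex q)) ?\<iota>"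
    by (simp add: singular_chain_of simplicial_imp_singular_simplex)
  have naturality: "chain_map q ?H (prism_op (q - 1) B' id (chain_boundary q ?\<iota>))
      = prism_op (q - 1) B' h (chain_boundary q (frag_of \<sigma>))"
  proof (cases "q = 0")
    case False
    then have q: "Suc (q - 1) = q" by simp
    have B': "singular_chain (Suc (q - 1)) (prism_space (q - 1)) B'"
      using B False by (simp add: is_prism_def)
    have "chain_map (Suc (q - 1)) ?H (prism_op (q - 1) B' id (chain_boundary q ?\<iota>))
        = prism_op (q - 1) B' h (chain_map (q - 1) \<sigma> (chain_boundary q ?\<iota>))"
      using singular_chain_boundary[OF \<iota>] by (intro chain_map_prism_op[OF B']) simp
    also have "chain_map (q - 1) \<sigma> (chain_boundary q ?\<iota>) = chain_boundary q (chain_map q \<sigma> ?\<iota>)"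
      by (simp only: chain_boundary_chain_map[OF \<iota>] One_nat_def)
    also have "chain_map q \<sigma> ?\<iota> = frag_of \<sigma>"
      by (rule singular_simplex_chain_map_id[OF \<sigma>])
    finally show ?thesis by (simp only: q)
  qed (simp add: chain_boundary_def)
  have "chain_boundary (Suc q) (prism_op q B h (frag_of \<sigma>)) = chain_map q ?H (chain_boundary (Suc q) B)"
    using B chain_boundary_chain_map[of "Suc q" "prism_space q" B ?H] by (simp add: prism_op_def is_prism_def)
  also have "\<dots> = frag_of (simplex_map q (\<lambda>x. h (1, x)) \<sigma>) - frag_of (simplex_map q (\<lambda>x. h (0, x)) \<sigma>)
      - prism_op (q - 1) B' h (chain_boundary q (frag_of \<sigma>))"
    using B naturality by (simp add: is_prism_def chain_map_diff simplex_map_prism_end[OF \<sigma>])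
  finally show ?case by simp
next
  case (diff a b)
  then show ?case
    by (simp add: prism_op_def chain_map_diff chain_boundary_diff frag_extend_diff)
qed (simp_all add: prism_op_def)

text \<open>
  The identity is homotopic to a constant map, which factors through a point, and in positive degree
  every cycle of a point is a boundary.
\<close>

lemma singular_boundary_contractible:
  assumes X: "contractible_space X" and q: "q > 0" and z: "singular_relcycle q X {} z"
  shows "\<exists>w. singular_chain (Suc q) X w \<and> chain_boundary (Suc q) w = z"
proof -
  obtain a where a: "homotopic_with (\<lambda>x. True) X X id (\<lambda>x. a)"
    using X by (auto simp: contractible_space_def)
  have zc: "singular_chain q X z"
    using z by (simp add: singular_cycle)
  have hom: "homologous_rel q X {} (chain_map q id z) (chain_map q (\<lambda>x. a) z)"
    by (rule homotopic_imp_homologous_rel_chain_maps[OF _ z, where V="{}"]) (use a in simp)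
  have "singular_relboundary q X {} (chain_map q (\<lambda>x. a) z)"
  proof (cases "topspace X = {}")
    case True
    then have "z = 0" using zc by (simp add: singular_chain_empty)
    then show ?thesis by simp
  next
    case False
    have "continuous_map X X (\<lambda>x. a)"
      using homotopic_with_imp_continuous_maps[OF a] by simp
    then have aX: "a \<in> topspace X" using False by (auto simp: continuous_map_def)
    then have "singular_relcycle q (subtopology X {a}) {} (chain_map q (\<lambda>x. a) z)"
      by (intro singular_relcycle_chain_map[OF z]) (auto simp: continuous_map_in_subtopology)
    then have "singular_relboundary q (subtopology X {a}) {} (chain_map q (\<lambda>x. a) z)"
      using q aX by (subst singular_boundary_eq_cycle_singleton[where a=a]) auto
    then show ?thesis
      using singular_boundary_mono[of "{a}" "topspace X" q X] aX by simp
  qed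
  moreover have "singular_relboundary q X {} (z - chain_map q (\<lambda>x. a) z)"
    using hom zc by (simp add: chain_map_ident homologous_rel_def)
  ultimately have "singular_relboundary q X {} z"
    using singular_relboundary_add by fastforce
  then show ?thesis by (simp add: singular_boundary)
qed

lemma contractible_prism_space: "contractible_space (prism_space q)"
proof -
  obtain a where a: "a \<in> standard_simplex q"
    using nonempty_standard_simplex by blast
  have "contractible_space (subtopology (powertop_real UNIV) (standard_simplex q))"
    unfolding contractible_space_def homotopic_with_def
  proof (intro exI conjI ballI)
    let ?h = "\<lambda>(s, x) i. (1 - s) * x i + s * a i"
    show "continuous_map (prod_topology (top_of_set {0..1})
        (subtopology (powertop_real UNIV) (standard_simplex q)))
        (subtopology (powertop_real UNIV) (standard_simplex q)) ?h"
      unfolding continuous_map_in_subtopology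
    proof
      have "continuous_map (prod_topology (top_of_set {0..1})
          (subtopology (powertop_real UNIV) (standard_simplex q))) euclideanreal (\<lambda>z. snd z i)" for i
        using continuous_map_compose[OF continuous_map_snd
            continuous_map_from_subtopology[OF continuous_map_product_projection[of i UNIV]]]
        by (auto simp: o_def)
      moreover have "continuous_map (prod_topology (top_of_set {0..1})
          (subtopology (powertop_real UNIV) (standard_simplex q))) euclideanreal fst"
        using continuous_map_into_fulltopology[OF continuous_map_fst] by blast
      ultimately show "continuous_map (prod_topology (top_of_set {0..1})
          (subtopology (powertop_real UNIV) (standard_simplex q))) (powertop_real UNIV) ?h"
        unfolding continuous_map_componentwise case_prod_unfold
        by (auto intro!: continuous_intros)
      show "?h \<in> topspace (prod_topology (top_of_set {0..1})
          (subtopology (powertop_real UNIV) (standard_simplex q))) \<rightarrow> standard_simplex q"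
        using a by (auto intro!: convex_standard_simplex)
    qed
  qed (auto simp: fun_eq_iff)
  moreover have "contractible_space (top_of_set {0..1::real})"
    by (simp add: contractible_space_top_of_set convex_imp_contractible)
  ultimately show ?thesis
    unfolding prism_space_def by (simp add: contractible_space_prod_topology)
qed

text \<open>
  In degree \<open>0\<close> a cycle of a contractible space need not bound, but here the two end points are the
  images of one \<open>0\<close>-cycle under homotopic maps.
\<close>

lemma prism_ends_cobound:
  "\<exists>B. singular_chain (Suc 0) (prism_space 0) B \<and>
     chain_boundary (Suc 0) B = frag_of (prism_end 0 1) - frag_of (prism_end 0 0)"
proof -
  let ?D = "subtopology (powertop_real UNIV) (standard_simplex 0)"
  let ?\<iota> = "frag_of (restrict id (standard_simplex 0))"
  have "singular_relcycle 0 ?D {} ?\<iota>"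
    by (simp add: singular_cycle singular_chain_of simplicial_imp_singular_simplex chain_boundary_def)
  moreover have "homotopic_with (\<lambda>h. h \<in> {} \<rightarrow> {}) ?D (prism_space 0) (\<lambda>x. (0, x)) (\<lambda>x. (1, x))"
    unfolding homotopic_with_def
    by (rule exI[of _ id]) (simp add: prism_space_def)
  ultimately have "homologous_rel 0 (prism_space 0) {}
      (chain_map 0 (\<lambda>x. (0, x)) ?\<iota>) (chain_map 0 (\<lambda>x. (1, x)) ?\<iota>)"
    using homotopic_imp_homologous_rel_chain_maps[where V="{}" and T="{}"] by blast
  then have "homologous_rel 0 (prism_space 0) {} (frag_of (prism_end 0 1)) (frag_of (prism_end 0 0))"
    by (simp only: chain_map_prism_end homologous_rel_sym)
  then show ?thesis
    by (simp add: homologous_rel_def singular_boundary)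
qed

text \<open>
  The prescribed boundary is a cycle by the homotopy formula one degree lower, applied to the boundary
  of the identity simplex, whose own boundary vanishes. It then bounds because the prism is
  contractible.
\<close>

lemma is_prism_extend:
  assumes B: "is_prism q B' B"
  shows "\<exists>B2. is_prism (Suc q) B B2"
proof -
  let ?D = "subtopology (powertop_real UNIV) (standard_simplex (Suc q))"
  let ?\<iota> = "frag_of (restrict id (standard_simplex (Suc q)))"
  let ?d = "chain_boundary (Suc q) ?\<iota>"
  let ?z = "frag_of (prism_end (Suc q) 1) - frag_of (prism_end (Suc q) 0) - prism_op q B id ?d"
  have id: "continuous_map (prod_topology (top_of_set {0..1}) ?D) (prism_space (Suc q)) id"
    by (simp add: prism_space_def)
  have \<iota>: "singular_chain (Suc q) ?D ?\<iota>"
    by (simp add: singular_chain_of simplicial_imp_singular_simplex)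
  have d: "singular_chain q ?D ?d"
    using singular_chain_boundary[OF \<iota>] by simp
  have end_boundary: "chain_boundary (Suc q) (frag_of (prism_end (Suc q) s)) = chain_map q (\<lambda>x. (s, x)) ?d"
    for s
    using chain_boundary_chain_map[OF \<iota>, of "\<lambda>x. (s, x)"] by (simp only: chain_map_prism_end) simp
  have cont: "continuous_map ?D (prism_space (Suc q)) (\<lambda>x. (s, x))" if "s \<in> {0..1}" for s
    unfolding prism_space_def using that by (intro continuous_map_pairedI) auto
  have ends: "singular_chain (Suc q) (prism_space (Suc q)) (frag_of (prism_end (Suc q) s))"
    if "s \<in> {0..1}" for s
    using singular_chain_chain_map[OF \<iota> cont[OF that]] by (simp only: chain_map_prism_end)
  have "singular_chain (Suc q) (prism_space (Suc q)) ?z"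
    using B by (intro singular_chain_diff ends singular_chain_prism_op[OF id _ d])
      (auto simp: is_prism_def)
  moreover have "chain_boundary (Suc q) ?z = 0"
    using chain_boundary_prism_op[OF id B d] chain_boundary_boundary_alt[OF \<iota>]
    by (simp add: chain_boundary_diff end_boundary)
  ultimately obtain w where "singular_chain (Suc (Suc q)) (prism_space (Suc q)) w"
      "chain_boundary (Suc (Suc q)) w = ?z"
    using singular_boundary_contractible[OF contractible_prism_space] by (metis singular_cycle zero_less_Suc)
  then show ?thesis
    using B by (intro exI[of _ w]) (simp add: is_prism_def)
qed

lemma prisms_exist: "\<exists>B. \<forall>q. is_prism q (B (q - 1)) (B q)"
proof -
  obtain B0 where B0: "is_prism 0 B0 B0"
    using prism_ends_cobound by (fastforce simp: is_prism_def chain_boundary_def)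
  obtain B where B: "\<And>q. \<exists>B'. is_prism q B' (B q)" "\<And>q. is_prism (Suc q) (B q) (B (Suc q))"
    using dependent_nat_choice[of "\<lambda>q C. \<exists>B'. is_prism q B' C" "\<lambda>q C C'. is_prism (Suc q) C C'"]
      B0 is_prism_extend by metis
  have "is_prism q (B (q - 1)) (B q)" for q
  proof (cases q)
    case 0
    then show ?thesis using B(1)[of 0] by (simp add: is_prism_def chain_boundary_def)
  next
    case (Suc n)
    then show ?thesis using B(2)[of n] by simp
  qed
  then show ?thesis by blast
qed

text \<open>
  Homotopy invariance over \<open>K\<close>: the integral prism operator is carried over to \<open>K\<close> simplex by simplex,
  and on a cycle its homotopy formula loses the last term.
\<close>

lemma fchain_map_homotopic:
  fixes z :: "('a, 'k::field) fchain" and h :: "real \<times> 'a \<Rightarrow> 'b"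
  assumes h: "continuous_map (prod_topology (top_of_set {0..1}) X) Y h" and z: "z \<in> fcycles p X"
  shows "fchain_map p (\<lambda>x. h (1, x)) z - fchain_map p (\<lambda>x. h (0, x)) z \<in> fboundaries p Y"
proof -
  obtain B where B: "\<And>q. is_prism q (B (q - 1)) (B q)"
    using prisms_exist by blast
  define D :: "nat \<Rightarrow> ('a, 'k) fchain \<Rightarrow> ('b, 'k) fchain"
    where "D q = fextend (\<lambda>\<sigma>. of_int_chain (prism_op q (B q) h (frag_of \<sigma>)))" for q
  have D_of_int: "D q (of_int_chain c) = of_int_chain (prism_op q (B q) h c)" for q c
    by (simp add: D_def prism_op_def of_int_chain_frag_extend)
  have D: "D q c \<in> fchains (Suc q) Y \<and>
      fboundary (Suc q) (D q c) =
        fchain_map q (\<lambda>x. h (1, x)) c - fchain_map q (\<lambda>x. h (0, x)) c - D (q - 1) (fboundary q c)"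
    if "c \<in> fchains q X" for c q
    using that
  proof (induction rule: fchain_induct)
    case zero
    show ?case by (simp add: D_def fchains_0 fboundary_linear fchain_map_linear)
  next
    case (add a b)
    then show ?case
      by (simp add: D_def fchains_add fboundary_linear fchain_map_linear fextend_add)
  next
    case (simplex \<sigma> a)
    then have \<sigma>: "singular_chain q X (frag_of \<sigma>)" by (simp add: singular_chain_of)
    have prism: "singular_chain (Suc q) Y (prism_op q (B q) h (frag_of \<sigma>))"
      using B[of q] by (intro singular_chain_prism_op[OF h _ \<sigma>]) (simp add: is_prism_def)
    have smult: "D r (fsmult a c) = fsmult a (D r c)" for r c
      by (simp add: D_def fextend_fsmult)
    show ?case
      unfolding smult fboundary_linear fchain_map_linear D_of_int fboundary_of_int_chain
        fchain_map_of_int_chain chain_boundary_prism_op[OF h B \<sigma>]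
      by (simp add: fchains_fsmult of_int_chain_in_fchains[OF prism] of_int_chain_diff fsmult_diff_right)
  qed
  have "z \<in> fchains p X" "fboundary p z = 0"
    using z by (simp_all add: fcycles_def)
  from D[OF this(1)] this(2) show ?thesis
    unfolding fboundaries_iff by (metis D_def fextend_0 diff_zero)
qed

text \<open>
  The retraction is the map on cycles to which \<open>fhomology_iso_induced\<close> applies. It moves a
  cycle of \<open>X\<close> only within its homology class, and it fixes the cycles of \<open>A\<close>.
\<close>

proposition fhomology_iso_deformation_retract:
  fixes h :: "real \<times> 'a \<Rightarrow> 'a"
  assumes h: "continuous_map (prod_topology (top_of_set {0..1}) X) X h"
    and h0: "\<And>x. x \<in> topspace X \<Longrightarrow> h (0, x) = x"
    and r: "continuous_map X (subtopology X A) (\<lambda>x. h (1, x))"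
    and fixed: "\<And>x. x \<in> topspace X \<inter> A \<Longrightarrow> h (1, x) = x"
  shows "fhomology_iso TYPE('k::field) p X (subtopology X A)"
proof (rule fhomology_iso_induced)
  let ?F = "fchain_map p (\<lambda>x. h (1, x)) :: ('a, 'k) fchain \<Rightarrow> ('a, 'k) fchain"
  let ?Y = "subtopology X A"
  have incl: "continuous_map ?Y X id"
    by (simp add: continuous_map_from_subtopology)
  have sub: "b \<in> fboundaries p X" if "b \<in> fboundaries p ?Y" for b :: "('a, 'k) fchain"
  proof -
    have "fchains (Suc p) ?Y \<subseteq> (fchains (Suc p) X :: ('a, 'k) fchain set)"
      by (auto simp: fchains_def singular_simplex_subtopology)
    then show ?thesis using that by (auto simp: fboundaries_def)
  qed
  show "?F u \<in> fcycles p ?Y" if "u \<in> fcycles p X" for u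
    using fchain_map_fcycles[OF that r] .
  show "?F (fsmult a u + v) = fsmult a (?F u) + ?F v" for a u v
    by (simp add: fchain_map_linear)
  show "?F u \<in> fboundaries p ?Y \<longleftrightarrow> u \<in> fboundaries p X" if u: "u \<in> fcycles p X" for u
  proof
    have "fchain_map p (\<lambda>x. h (0, x)) u = u"
      using u h0 by (intro fchain_map_eq_id) (auto simp: fcycles_def)
    with fchain_map_homotopic[OF h u] have hom: "?F u - u \<in> fboundaries p X"
      by simp
    assume "?F u \<in> fboundaries p ?Y"
    from fboundaries_diff[OF sub[OF this] hom] show "u \<in> fboundaries p X" by simp
  qed (rule fchain_map_fboundaries[OF _ r])
  show "\<exists>u\<in>fcycles p X. v - ?F u \<in> fboundaries p ?Y" if v: "v \<in> fcycles p ?Y" for v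
  proof
    have "fchain_map p id v = v" "?F v = v"
      using v fixed by (auto intro!: fchain_map_eq_id simp: fcycles_def)
    then show "v \<in> fcycles p X" "v - ?F v \<in> fboundaries p ?Y"
      using fchain_map_fcycles[OF v incl] fboundaries_0 by simp_all
  qed
qed

section \<open>Intrinsic distance and nets\<close>

lemma dist_le_curve_length: "ereal (dist (g 0) (g 1)) \<le> curve_length g"
proof -
  let ?s = "\<lambda>i::nat. if i = 0 then 0 else 1::real"
  have "mono ?s" "range ?s \<subseteq> {0..1}"
    by (auto simp: mono_def)
  then show ?thesis
    unfolding curve_length_def by (intro SUP_upper2[of "(1, ?s)"]) auto
qed

lemma dist_le_intrinsic_dist: "ereal (dist x y) \<le> intrinsic_dist M x y"
  unfolding intrinsic_dist_def
  using dist_le_curve_length by (auto intro!: Inf_greatest simp: pathstart_def pathfinish_def)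

text \<open>
  A partition \<open>s\<close> of the joined path is transferred to both halves by clamping: \<open>u = min 1 (2 s)\<close> and
  \<open>v = max 0 (2 s - 1)\<close>. Outside its half a clamped partition is constant and contributes nothing, and
  a step that crosses the junction is split there by the triangle inequality. So no index has to be
  found at which \<open>s\<close> passes \<open>1/2\<close>.
\<close>

lemma curve_length_joinpaths:
  assumes "pathfinish g = pathstart h"
  shows "curve_length (g +++ h) \<le> curve_length g + curve_length h"
  unfolding curve_length_def[of "g +++ h"]
proof (rule SUP_least, clarify)
  fix n and s :: "nat \<Rightarrow> real"
  assume s: "mono s" "range s \<subseteq> {0..1}"
  define u where "u i = min 1 (2 * s i)" for i
  define v where "v i = max 0 (2 * s i - 1)" for i
  have u: "mono u" "range u \<subseteq> {0..1}"
    unfolding u_def using s by (auto intro!: monoI min.mono simp: monoD image_subset_iff)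
  have v: "mono v" "range v \<subseteq> {0..1}"
    unfolding v_def using s by (auto intro!: monoI max.mono simp: monoD image_subset_iff)
  have step: "dist ((g +++ h) a) ((g +++ h) b) \<le>
      dist (g (min 1 (2 * a))) (g (min 1 (2 * b))) + dist (h (max 0 (2 * a - 1))) (h (max 0 (2 * b - 1)))"
    if "a \<le> b" for a b
  proof -
    have g1: "g 1 = h 0" using assms by (simp add: pathstart_def pathfinish_def)
    have left: "(g +++ h) x = g (min 1 (2 * x))" "h (max 0 (2 * x - 1)) = h 0" if "x \<le> 1/2" for x
      using that by (simp_all add: joinpaths_def)
    have right: "(g +++ h) x = h (max 0 (2 * x - 1))" "g (min 1 (2 * x)) = h 0" if "x \<ge> 1/2" for x
    proof -
      have "min 1 (2 * x) = 1" using that by simp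
      then show "g (min 1 (2 * x)) = h 0" using g1 by simp
      show "(g +++ h) x = h (max 0 (2 * x - 1))"
      proof (cases "x = 1/2")
        case True
        show ?thesis unfolding True using g1 by (simp add: joinpaths_def)
      next
        case False
        then show ?thesis using that by (simp add: joinpaths_def)
      qed
    qed
    consider "b \<le> 1/2" | "a \<le> 1/2" "b \<ge> 1/2" | "a \<ge> 1/2" by linarith
    then show ?thesis
    proof cases
      case 1
      then show ?thesis using left[of a] left[of b] \<open>a \<le> b\<close> by simp
    next
      case 2
      then show ?thesis
        by (simp only: left[OF 2(1)] right[OF 2(2)] dist_triangle)
    next
      case 3
      then show ?thesis using right[of a] right[of b] \<open>a \<le> b\<close> by simp
    qed
  qed
  have "(\<Sum>i<n. ereal (dist ((g +++ h) (s i)) ((g +++ h) (s (Suc i))))) \<le>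
      (\<Sum>i<n. ereal (dist (g (u i)) (g (u (Suc i)))) + ereal (dist (h (v i)) (h (v (Suc i)))))"
    using step s(1) by (intro sum_mono) (simp add: u_def v_def mono_def)
  also have "\<dots> = (\<Sum>i<n. ereal (dist (g (u i)) (g (u (Suc i))))) + (\<Sum>i<n. ereal (dist (h (v i)) (h (v (Suc i)))))"
    by (rule sum.distrib)
  also have "\<dots> \<le> curve_length g + curve_length h"
    unfolding curve_length_def using u v
    by (intro add_mono SUP_upper2[of "(n, u)"] SUP_upper2[of "(n, v)"]) auto
  finally show "(\<Sum>i<n. ereal (dist ((g +++ h) (s i)) ((g +++ h) (s (Suc i))))) \<le> curve_length g + curve_length h" .
qed

text \<open>
  The triangle inequality, stated with strict real bounds: this form spares sums of possibly infinite
  values, and strict bounds are what membership in balls provides.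
\<close>

lemma intrinsic_dist_less_trans:
  assumes "intrinsic_dist M x y < ereal a" "intrinsic_dist M y z < ereal b"
  shows "intrinsic_dist M x z < ereal (a + b)"
proof -
  obtain g where g: "path g" "path_image g \<subseteq> M" "pathstart g = x" "pathfinish g = y" "curve_length g < ereal a"
    using assms(1) by (auto simp: intrinsic_dist_def Inf_less_iff)
  obtain h where h: "path h" "path_image h \<subseteq> M" "pathstart h = y" "pathfinish h = z" "curve_length h < ereal b"
    using assms(2) by (auto simp: intrinsic_dist_def Inf_less_iff)
  have len: "curve_length (g +++ h) < ereal (a + b)"
  proof -
    have "curve_length g + curve_length h < ereal a + ereal b"
      using g(5) h(5) by (intro ereal_add_strict_mono2)
    then show ?thesis
      using curve_length_joinpaths[of g h] g(4) h(3) by (simp add: order_le_less_trans)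
  qed
  moreover have "path_image (g +++ h) \<subseteq> M"
    using g h by (simp add: path_image_join)
  moreover have "curve_length (g +++ h) < \<infinity>"
    using len by (auto simp: less_top[symmetric])
  ultimately have "intrinsic_dist M x z \<le> curve_length (g +++ h)"
    unfolding intrinsic_dist_def using g h by (intro Inf_lower) (auto simp: path_join)
  then show ?thesis using len by simp
qed

lemma intrinsic_ball_subset_ball: "intrinsic_ball M x \<epsilon> \<subseteq> ball x \<epsilon>"
proof
  fix y assume "y \<in> intrinsic_ball M x \<epsilon>"
  then have "ereal (dist x y) < ereal \<epsilon>"
    using dist_le_intrinsic_dist[of x y M] unfolding intrinsic_ball_def by (blast intro: order_le_less_trans)
  then show "y \<in> ball x \<epsilon>" by simp
qed

definition locally_quasiconvex :: "'a::euclidean_space set \<Rightarrow> bool" where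
  "locally_quasiconvex M \<longleftrightarrow> (\<exists>c\<ge>1. \<exists>\<rho>>0. \<forall>x\<in>M. \<forall>y\<in>M. dist x y < \<rho> \<longrightarrow>
     intrinsic_dist M x y \<le> ereal (c * dist x y))"

text \<open>
  The Euclidean distance controls the intrinsic one at small scale, so a point that is Euclidean close
  to a point of the ball costs less than the slack left to \<open>\<epsilon>\<close>. Hence balls are Borel sets, and by
  compactness finite nets exist.
\<close>

lemma openin_intrinsic_ball:
  assumes "locally_quasiconvex M"
  shows "openin (top_of_set M) (intrinsic_ball M x \<epsilon>)"
proof -
  obtain c \<rho> where c: "c \<ge> 1" "\<rho> > 0"
    and le: "\<And>x y. x \<in> M \<Longrightarrow> y \<in> M \<Longrightarrow> dist x y < \<rho> \<Longrightarrow> intrinsic_dist M x y \<le> ereal (c * dist x y)"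
    using assms by (auto simp: locally_quasiconvex_def)
  have "\<exists>e>0. \<forall>z\<in>M. dist z y < e \<longrightarrow> z \<in> intrinsic_ball M x \<epsilon>" if y: "y \<in> intrinsic_ball M x \<epsilon>" for y
  proof -
    obtain a where a: "intrinsic_dist M x y < ereal a" "a < \<epsilon>"
      using y ereal_dense2[of "intrinsic_dist M x y" "ereal \<epsilon>"] by (auto simp: intrinsic_ball_def)
    have "z \<in> intrinsic_ball M x \<epsilon>" if z: "z \<in> M" "dist z y < min \<rho> ((\<epsilon> - a) / c)" for z
    proof -
      have "intrinsic_dist M y z \<le> ereal (c * dist y z)"
        using y z by (intro le) (auto simp: intrinsic_ball_def dist_commute)
      also have "\<dots> < ereal (\<epsilon> - a)"
        using z(2) c(1) by (simp add: field_simps dist_commute)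
      finally show ?thesis
        using intrinsic_dist_less_trans[OF a(1)] z(1) by (fastforce simp: intrinsic_ball_def)
    qed
    moreover have "min \<rho> ((\<epsilon> - a) / c) > 0" using c a by simp
    ultimately show ?thesis by blast
  qed
  then show ?thesis
    by (auto simp: openin_euclidean_subtopology_iff intrinsic_ball_def)
qed

lemma centre_in_intrinsic_ball:
  assumes "locally_quasiconvex M" "x \<in> M" "\<epsilon> > 0"
  shows "x \<in> intrinsic_ball M x \<epsilon>"
proof -
  have "intrinsic_dist M x x \<le> 0"
    using assms(1,2) by (fastforce simp: locally_quasiconvex_def zero_ereal_def)
  then show ?thesis
    using assms(2,3) by (auto simp: intrinsic_ball_def zero_ereal_def intro: order_le_less_trans)
qed

lemma target_family_intrinsic_balls:
  assumes "locally_quasiconvex M" "closed M" "finite N"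
  shows "target_family M ((\<lambda>x. intrinsic_ball M x \<epsilon>) ` N)"
proof -
  have "intrinsic_ball M x \<epsilon> \<in> sets borel" for x
  proof -
    obtain T where "open T" "intrinsic_ball M x \<epsilon> = M \<inter> T"
      using openin_intrinsic_ball[OF assms(1), of x \<epsilon>] unfolding openin_open by blast
    then show ?thesis using assms(2) by auto
  qed
  then show ?thesis
    using assms(3) by (auto simp: target_family_def intrinsic_ball_def)
qed

lemma intrinsic_net_exists:
  assumes M: "locally_quasiconvex M" "compact M" and "\<epsilon> > 0"
  shows "\<exists>N. intrinsic_net M \<epsilon> N"
proof -
  have "\<forall>x. \<exists>T. open T \<and> intrinsic_ball M x \<epsilon> = M \<inter> T"
    using openin_intrinsic_ball[OF M(1)] by (simp add: openin_open)
  then obtain T where T: "\<And>x. open (T x)" "\<And>x. intrinsic_ball M x \<epsilon> = M \<inter> T x"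
    by metis
  have "M \<subseteq> (\<Union>x\<in>M. T x)"
    using centre_in_intrinsic_ball[OF M(1) _ \<open>\<epsilon> > 0\<close>] T(2) by blast
  then obtain N where N: "N \<subseteq> M" "finite N" "M \<subseteq> (\<Union>x\<in>N. T x)"
    using compactE_image[OF M(2), of M T] T(1) by metis
  then have "M \<subseteq> (\<Union>x\<in>N. intrinsic_ball M x \<epsilon>)"
    using T(2) by auto
  then show ?thesis
    using N(1,2) by (auto simp: intrinsic_net_def)
qed

lemma minimal_net_exists:
  assumes "locally_quasiconvex M" "compact M" "\<epsilon> > 0"
  shows "\<exists>N. intrinsic_net M \<epsilon> N \<and> card N = net_number M \<epsilon>"
  unfolding net_number_def
  by (rule LeastI_ex) (use intrinsic_net_exists[OF assms] in blast)

text \<open>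
  Two centres with the same ball would make one of them redundant. Hence a minimal net and its family of
  balls have the same number of elements.
\<close>

lemma inj_on_minimal_net:
  assumes N: "intrinsic_net M \<epsilon> N" "card N = net_number M \<epsilon>"
  shows "inj_on (\<lambda>x. intrinsic_ball M x \<epsilon>) N"
proof (rule inj_onI, rule ccontr)
  fix x y assume xy: "x \<in> N" "y \<in> N" "intrinsic_ball M x \<epsilon> = intrinsic_ball M y \<epsilon>" "x \<noteq> y"
  then have "(\<Union>z\<in>N. intrinsic_ball M z \<epsilon>) \<subseteq> (\<Union>z\<in>N - {y}. intrinsic_ball M z \<epsilon>)"
    by blast
  then have "intrinsic_net M \<epsilon> (N - {y})"
    using N(1) unfolding intrinsic_net_def by auto
  then have "net_number M \<epsilon> \<le> card (N - {y})"
    unfolding net_number_def by (intro Least_le) blast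
  moreover have "card (N - {y}) < card N"
    using N(1) xy(2) by (intro card_Diff1_less) (auto simp: intrinsic_net_def)
  ultimately show False using N(2) by simp
qed

section \<open>Nearest points below the reach\<close>

definition unique_nearest :: "'a::euclidean_space set \<Rightarrow> real \<Rightarrow> bool" where
  "unique_nearest M R \<longleftrightarrow>
     (\<forall>z. 0 < infdist z M \<and> infdist z M < R \<longrightarrow> (\<exists>!p. p \<in> M \<and> dist z p = infdist z M))"

lemma unique_nearest_below_reach:
  assumes "ereal t < reach M"
  shows "\<exists>R>t. unique_nearest M R"
  using assms unfolding reach_def less_Sup_iff unique_nearest_def by auto

lemma norm_scaleR_diff_squared:
  fixes w v :: "'a::real_inner"
  shows "(norm (c *\<^sub>R w - v))\<^sup>2 = c\<^sup>2 * (norm w)\<^sup>2 - 2 * c * (w \<bullet> v) + (norm v)\<^sup>2"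
  unfolding power2_norm_eq_inner
  by (simp add: inner_diff_left inner_diff_right inner_commute power2_eq_square algebra_simps)

lemma closest_point_dist:
  fixes M :: "'a::euclidean_space set"
  assumes "closed M" "M \<noteq> {}"
  shows "closest_point M z \<in> M" "dist z (closest_point M z) = infdist z M"
proof -
  show in_M: "closest_point M z \<in> M" by (rule closest_point_in_set[OF assms])
  obtain q where "q \<in> M" "infdist z M = dist z q"
    using infdist_attains_inf[OF assms] by blast
  then show "dist z (closest_point M z) = infdist z M"
    using closest_point_le[OF assms(1), of q z] infdist_le[OF in_M, of z] by simp
qed

context
  fixes M :: "'a::euclidean_space set" and R :: real
  assumes M: "compact M" "M \<noteq> {}" and R: "unique_nearest M R"
begin

lemmas nearest = closest_point_dist[OF compact_imp_closed[OF M(1)] M(2)]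

lemma nearest_unique:
  assumes "infdist z M < R" "p \<in> M" "dist z p = infdist z M"
  shows "closest_point M z = p"
proof (cases "infdist z M = 0")
  case True
  then show ?thesis using nearest(2)[of z] assms(3) by simp
next
  case False
  then have "0 < infdist z M" using infdist_nonneg[of z M] by simp
  then show ?thesis
    using R assms nearest unfolding unique_nearest_def by metis
qed

text \<open>
  The graph of the projection is cut out by a closed condition, thanks to uniqueness, and the values
  lie in a compact set.
\<close>

lemma continuous_on_nearest: "continuous_on {z. infdist z M < R} (closest_point M)"
proof -
  let ?S = "{z. infdist z M < R}"
  have "(\<lambda>z. (z, closest_point M z)) ` ?S = (?S \<times> M) \<inter> {w. dist (fst w) (snd w) = infdist (fst w) M}"
    using nearest nearest_unique by (auto simp: image_iff)
  moreover have "closed {w. dist (fst w) (snd w) = infdist (fst w) M}"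
    by (intro closed_Collect_eq continuous_intros)
  ultimately have "closedin (top_of_set (?S \<times> M)) ((\<lambda>z. (z, closest_point M z)) ` ?S)"
    by (simp add: closedin_closed_Int)
  then show ?thesis
    using nearest by (subst continuous_closed_graph_eq[OF M(1)]) auto
qed

text \<open>
  If \<open>p\<close> is nearest to \<open>x\<close>, it stays nearest when \<open>x\<close> moves away from \<open>p\<close> along their ray, up to
  distance \<open>R\<close>. Let \<open>\<pi>\<close> be the projection, and let \<open>f\<close> send \<open>z\<close> to the point at distance \<open>a\<close>
  from \<open>x\<close> in the direction from \<open>\<pi> z\<close> to \<open>x\<close>. This is a continuous self-map of the ball of radius
  \<open>a\<close> about \<open>x\<close>, so it has a fixed point \<open>z\<close> by Brouwer's theorem. Then \<open>x\<close> lies between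
  \<open>\<pi> z\<close> and \<open>z\<close>. Since \<open>infdist z M\<close> exceeds \<open>infdist x M\<close> by at most \<open>a\<close>, the point \<open>\<pi> z\<close> is
  nearest to \<open>x\<close> as well, so it is \<open>p\<close>, and \<open>z\<close> is the desired point of the ray.
\<close>

lemma nearest_ray_extends:
  assumes p: "p \<in> M" "dist x p = infdist x M" "x \<noteq> p" and a: "0 \<le> a" "dist x p + a < R"
  shows "infdist (x + (a / dist x p) *\<^sub>R (x - p)) M = dist x p + a"
proof -
  define f where "f z = x + (a / dist x (closest_point M z)) *\<^sub>R (x - closest_point M z)" for z
  have pos: "0 < infdist x M" using p by (metis dist_nz)
  then have away: "dist x (closest_point M z) \<ge> infdist x M" "dist x (closest_point M z) > 0" for z
    using infdist_le[OF nearest(1), of x z] by linarith+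
  have "cball x a \<subseteq> {z. infdist z M < R}"
  proof clarify
    fix z assume "z \<in> cball x a"
    then show "infdist z M < R"
      using infdist_triangle[of z M x] a(2) p(2) by (simp add: dist_commute)
  qed
  then have "continuous_on (cball x a) (closest_point M)"
    by (rule continuous_on_subset[OF continuous_on_nearest])
  then have "continuous_on (cball x a) f"
    unfolding f_def using away(2) by (intro continuous_intros) (auto simp: order_less_imp_not_eq2)
  moreover have "f \<in> cball x a \<rightarrow> cball x a"
    using away(2) a(1) by (auto simp: f_def dist_norm)
  ultimately obtain z where z: "z \<in> cball x a" "f z = z"
    using brouwer[OF compact_cball convex_cball, of x a f] a(1) by auto
  \<comment> \<open>At the fixed point, \<open>q\<close>, \<open>x\<close> and \<open>z\<close> lie on a line in this order.\<close>
  define q where "q = closest_point M z"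
  have q: "q \<in> M" "dist z q = infdist z M" "dist x q > 0" "dist x q \<ge> infdist x M"
    using nearest away by (auto simp: q_def)
  have zq: "z = x + (a / dist x q) *\<^sub>R (x - q)"
    using z(2) by (simp add: f_def q_def)
  have "z - q = (1 + a / dist x q) *\<^sub>R (x - q)"
    by (simp add: zq algebra_simps)
  then have "dist z q = (1 + a / dist x q) * dist x q"
    using a(1) q(3) by (simp add: dist_norm)
  then have zq_dist: "infdist z M = dist x q + a"
    using q by (simp add: field_simps)
  moreover have "infdist z M \<le> infdist x M + a"
    using infdist_triangle[of z M x] z(1) by (simp add: dist_commute)
  ultimately have "dist x q = infdist x M" using q(4) by simp
  moreover have "infdist x M < R" using a p(2) by simp
  ultimately have "q = p"
    using nearest_unique[of x q] nearest_unique[of x p] p q(1) by simp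
  then show ?thesis using zq zq_dist by simp
qed

text \<open>
  Federer's inequality: the ball of radius \<open>t\<close> that touches \<open>M\<close> at \<open>p\<close> from the side of \<open>x\<close> has no
  point of \<open>M\<close> in its interior, by the extension of the ray. Hence \<open>s\<close> is outside this ball, which is
  the claim once the squared distance from \<open>s\<close> to the centre is expanded.
\<close>

lemma nearest_inner_le:
  assumes p: "p \<in> M" "dist x p = infdist x M" and s: "s \<in> M" and t: "dist x p < t" "t < R"
  shows "2 * t * ((x - p) \<bullet> (s - p)) \<le> dist x p * (dist s p)\<^sup>2"
proof (cases "x = p")
  case False
  define \<rho> where "\<rho> = dist x p"
  have \<rho>: "\<rho> > 0" using False by (simp add: \<rho>_def)
  define z where "z = x + ((t - \<rho>) / \<rho>) *\<^sub>R (x - p)"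
  have "infdist z M = t"
    using nearest_ray_extends[OF p False, of "t - \<rho>"] t by (simp add: z_def \<rho>_def)
  then have "t \<le> dist z s" using infdist_le[OF s, of z] by simp
  moreover have "z - s = (t / \<rho>) *\<^sub>R (x - p) - (s - p)"
    using \<rho> by (simp add: z_def diff_divide_distrib algebra_simps)
  ultimately have "t\<^sup>2 \<le> (norm ((t / \<rho>) *\<^sub>R (x - p) - (s - p)))\<^sup>2"
    using t(1) \<rho> unfolding \<rho>_def[symmetric] by (intro power_mono) (auto simp: dist_norm)
  also have "\<dots> = (t / \<rho>)\<^sup>2 * \<rho>\<^sup>2 - 2 * (t / \<rho>) * ((x - p) \<bullet> (s - p)) + (dist s p)\<^sup>2"
    by (simp add: norm_scaleR_diff_squared \<rho>_def dist_norm)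
  also have "(t / \<rho>)\<^sup>2 * \<rho>\<^sup>2 = t\<^sup>2" using \<rho> by (simp add: power_divide)
  finally have "2 * (t / \<rho>) * ((x - p) \<bullet> (s - p)) \<le> (dist s p)\<^sup>2" by simp
  then show ?thesis using \<rho> unfolding \<rho>_def[symmetric] by (simp add: field_simps)
qed simp

text \<open>
  Let \<open>p\<close> be the nearest point to \<open>x\<close> and \<open>y\<close> a point of the segment. If \<open>y\<close> is within \<open>r/2\<close> of \<open>p\<close>,
  a point of \<open>S\<close> near \<open>p\<close> is close enough. Otherwise take the point \<open>s\<close> of \<open>S\<close> nearest to \<open>x\<close>: it is
  within \<open>2 r\<close> of \<open>p\<close>, and Federer's inequality with \<open>t = 4 r\<close> shows that \<open>s - p\<close> points so little
  towards \<open>x\<close> that moving from \<open>x\<close> to \<open>y\<close> does not increase the distance to \<open>s\<close>.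
\<close>

lemma segment_to_nearest_in_thickening:
  assumes S: "S \<subseteq> M" "compact S" "S \<noteq> {}" and dense: "\<And>p. p \<in> M \<Longrightarrow> \<exists>s\<in>S. dist p s \<le> \<delta>"
    and r: "0 < r" "2 * \<delta> \<le> r" "4 * r < R"
    and x: "x \<in> thickening S r" and u: "0 \<le> u" "u \<le> 1"
  shows "closest_point M x + u *\<^sub>R (x - closest_point M x) \<in> thickening S r"
proof -
  define p where "p = closest_point M x"
  define y where "y = p + u *\<^sub>R (x - p)"
  have p: "p \<in> M" "dist x p = infdist x M"
    using nearest by (simp_all add: p_def)
  have xS: "infdist x S \<le> r" using x by (simp add: thickening_def)
  have \<rho>r: "dist x p \<le> r"
    using infdist_mono[OF S(1,3), of x] xS p(2) by simp
  have "infdist y S \<le> r"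
  proof (cases "u * dist x p \<le> r / 2")
    case True
    obtain s where s: "s \<in> S" "dist p s \<le> \<delta>" using dense[OF p(1)] by blast
    have "dist y s \<le> dist y p + dist p s" by (rule dist_triangle)
    also have "dist y p = u * dist x p" using u by (simp add: y_def dist_norm)
    finally show ?thesis using infdist_le[OF s(1), of y] s(2) True r(2) by linarith
  next
    case False
    obtain s where s: "s \<in> S" "infdist x S = dist x s"
      using infdist_attains_inf[OF compact_imp_closed[OF S(2)] S(3)] by blast
    define w v where "w = x - p" and "v = s - p"
    have "u * dist x p \<le> 1 * dist x p" using u by (intro mult_right_mono) auto
    then have \<rho>: "dist x p > r / 2" using False by linarith
    then have \<rho>0: "0 < dist x p" using r(1) by linarith
    have "dist s p \<le> 2 * r"
      using dist_triangle[of s p x] s(2) xS \<rho>r by (simp add: dist_commute)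
    then have "(dist s p)\<^sup>2 \<le> (2 * r)\<^sup>2" by (intro power_mono) auto
    have "2 * (4 * r) * (w \<bullet> v) \<le> dist x p * (dist s p)\<^sup>2"
      unfolding w_def v_def using s(1) S(1) \<rho>r r by (intro nearest_inner_le p) auto
    also have "\<dots> \<le> dist x p * (2 * r)\<^sup>2"
      using \<open>(dist s p)\<^sup>2 \<le> (2 * r)\<^sup>2\<close> by (intro mult_left_mono) auto
    also have "\<dots> = 8 * r * (dist x p * r / 2)" by (simp add: power2_eq_square)
    finally have "8 * r * (w \<bullet> v) \<le> 8 * r * (dist x p * r / 2)" by simp
    then have inner: "2 * (w \<bullet> v) \<le> dist x p * r"
      using r(1) by (simp add: mult_le_cancel_left_pos mult.commute)
    have "dist x p * r \<le> dist x p * ((1 + u) * dist x p)"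
      using False \<rho> by (intro mult_left_mono) (auto simp: algebra_simps)
    also have "\<dots> = (1 + u) * (dist x p)\<^sup>2" by (simp add: power2_eq_square)
    finally have "0 \<le> (1 - u) * ((1 + u) * (dist x p)\<^sup>2 - 2 * (w \<bullet> v))"
      using inner u by (intro mult_nonneg_nonneg) simp_all
    also have "\<dots> = (norm (w - v))\<^sup>2 - (norm (u *\<^sub>R w - v))\<^sup>2"
      using norm_scaleR_diff_squared[of 1 w v] norm_scaleR_diff_squared[of u w v]
      by (simp add: dist_norm w_def[symmetric] power2_eq_square algebra_simps)
    finally have "(norm (u *\<^sub>R w - v))\<^sup>2 \<le> (norm (w - v))\<^sup>2" by simp
    then have "norm (u *\<^sub>R w - v) \<le> norm (w - v)"
      by (rule power2_le_imp_le) simp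
    moreover have "y - s = u *\<^sub>R w - v" "x - s = w - v"
      by (simp_all add: y_def w_def v_def)
    ultimately have "dist y s \<le> dist x s"
      by (simp only: dist_norm)
    then show ?thesis using infdist_le[OF s(1), of y] s(2) xS by linarith
  qed
  then show ?thesis by (simp add: thickening_def y_def p_def)
qed

end

section \<open>Certificates from nets\<close>

text \<open>
  The straight-line homotopy from the identity to the nearest-point projection deforms the thickening
  of \<open>S\<close> onto \<open>M\<close>.
\<close>

proposition fhomology_iso_thickening_dense:
  fixes M :: "'a::euclidean_space set"
  assumes M: "compact M" "M \<noteq> {}" and R: "unique_nearest M R"
    and S: "S \<subseteq> M" "compact S" "S \<noteq> {}" and dense: "\<And>p. p \<in> M \<Longrightarrow> \<exists>s\<in>S. dist p s \<le> \<delta>"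
    and r: "0 < r" "2 * \<delta> \<le> r" "4 * r < R"
  shows "fhomology_iso TYPE('k::field) q (top_of_set (thickening S r)) (top_of_set M)"
proof -
  let ?T = "thickening S r" and ?\<pi> = "closest_point M"
  define h where "h = (\<lambda>(t, x). ?\<pi> x + (1 - t) *\<^sub>R (x - ?\<pi> x))"
  have M_sub: "M \<subseteq> ?T"
  proof
    fix p assume "p \<in> M"
    then obtain s where s: "s \<in> S" "dist p s \<le> \<delta>" using dense by blast
    have "\<delta> \<ge> 0" using s(2) order_trans[OF zero_le_dist] by blast
    then show "p \<in> ?T"
      using infdist_le[OF s(1), of p] s(2) r(2) by (simp add: thickening_def)
  qed
  have "?T \<subseteq> {z. infdist z M < R}"
    using infdist_mono[OF S(1,3)] r unfolding thickening_def
    by (smt (verit) Collect_mono)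
  then have "continuous_on ?T ?\<pi>"
    by (rule continuous_on_subset[OF continuous_on_nearest[OF M R]])
  then have "continuous_on ({0..1} \<times> ?T) (\<lambda>z. ?\<pi> (snd z))"
    by (rule continuous_on_compose2) (auto intro: continuous_intros)
  then have "continuous_on ({0..1} \<times> ?T) h"
    unfolding h_def case_prod_unfold by (intro continuous_intros)
  moreover have "h ` ({0..1} \<times> ?T) \<subseteq> ?T"
    using segment_to_nearest_in_thickening[OF M R S dense r] by (auto simp: h_def)
  ultimately have cont_h: "continuous_map (prod_topology (top_of_set {0..1}) (top_of_set ?T)) (top_of_set ?T) h"
    by (auto simp: prod_topology_subtopology_eu)
  have \<pi>: "?\<pi> x \<in> M" "x \<in> M \<Longrightarrow> ?\<pi> x = x" for x
    using closest_point_dist(1)[OF compact_imp_closed[OF M(1)] M(2)] by (auto intro: closest_point_self)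
  have "fhomology_iso TYPE('k) q (top_of_set ?T) (subtopology (top_of_set ?T) M)"
  proof (rule fhomology_iso_deformation_retract[OF cont_h])
    show "continuous_map (top_of_set ?T) (subtopology (top_of_set ?T) M) (\<lambda>x. h (1, x))"
      using \<open>continuous_on ?T ?\<pi>\<close> \<pi>(1) M_sub
      by (auto simp: h_def subtopology_subtopology)
  qed (use \<pi> in \<open>auto simp: h_def\<close>)
  then show ?thesis
    using M_sub by (simp add: subtopology_subtopology Int_absorb1)
qed

text \<open>
  A path that meets all balls of the net comes within \<open>2 \<epsilon>\<close> of every point of \<open>M\<close>, through the
  centre of a ball that contains the point. With \<open>\<delta> = 2 \<epsilon>\<close> the condition \<open>2 \<delta> \<le> r\<close> is the lower
  bound on \<open>r\<close>. The upper bound gives \<open>4 r < reach M\<close>; the factor \<open>1/8\<close> rather than \<open>1/4\<close> makes this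
  strict, so that some radius \<open>R > 4 r\<close> has unique nearest points.
\<close>

lemma net_balls_full_certificate:
  fixes M :: "'a::euclidean_space set"
  assumes M: "compact M" "M \<noteq> {}" "locally_quasiconvex M" and N: "intrinsic_net M \<epsilon> N"
    and \<epsilon>: "\<epsilon> > 0" and r: "4 * \<epsilon> \<le> r" "ereal r \<le> ereal (1/8) * reach M"
  shows "full_homological_certificate TYPE('k::field) M r ((\<lambda>x. intrinsic_ball M x \<epsilon>) ` N)"
  unfolding full_homological_certificate_def
proof (intro conjI allI impI)
  show "target_family M ((\<lambda>x. intrinsic_ball M x \<epsilon>) ` N)"
    using target_family_intrinsic_balls[OF M(3)] M(1) N
    by (simp add: compact_imp_closed intrinsic_net_def)
next
  fix T :: real and \<gamma> :: "real \<Rightarrow> 'a" and q :: nat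
  assume T: "0 \<le> T" and \<gamma>: "continuous_on {0..T} \<gamma>" "\<gamma> ` {0..T} \<subseteq> M"
    and hits: "hits_all \<gamma> T ((\<lambda>x. intrinsic_ball M x \<epsilon>) ` N)"
  have "ereal (4 * r) < reach M"
    using r \<epsilon> by (cases "reach M") (auto simp: field_simps)
  then obtain R where R: "4 * r < R" "unique_nearest M R"
    using unique_nearest_below_reach by blast
  have "\<exists>s\<in>\<gamma> ` {0..T}. dist p s \<le> 2 * \<epsilon>" if "p \<in> M" for p
  proof -
    obtain x where x: "x \<in> N" "p \<in> intrinsic_ball M x \<epsilon>"
      using N \<open>p \<in> M\<close> by (auto simp: intrinsic_net_def)
    obtain s where s: "s \<in> \<gamma> ` {0..T}" "s \<in> intrinsic_ball M x \<epsilon>"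
      using hits x(1) unfolding hits_all_def by blast
    have "dist x p < \<epsilon>" "dist x s < \<epsilon>"
      using x(2) s(2) intrinsic_ball_subset_ball[of M x \<epsilon>] by auto
    then have "dist p s \<le> 2 * \<epsilon>"
      using dist_triangle3[of p s x] by linarith
    then show ?thesis using s(1) by blast
  qed
  then show "fhomology_iso TYPE('k) q (top_of_set (thickening (\<gamma> ` {0..T}) r)) (top_of_set M)"
    using T \<gamma> r(1) \<epsilon> R(1)
    by (intro fhomology_iso_thickening_dense[OF M(1,2) R(2), where \<delta>="2 * \<epsilon>"] compact_continuous_image) auto
qed

theorem proposition3p4:
  fixes M U :: "'a::euclidean_space set"
    and \<Omega> :: "'w measure" and P :: "'a \<Rightarrow> 'w measure" and X :: "real \<Rightarrow> 'w \<Rightarrow> 'a"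
  assumes dim: "DIM('a) \<ge> 2"
    and U: "open U" "connected U" "bounded U" "U \<noteq> {}"
    and M: "M = closure U"
    and reach: "reach M > 0"
    and intrinsic: "\<exists>c\<ge>1. \<exists>\<rho>>0. \<forall>x\<in>M. \<forall>y\<in>M. dist x y < \<rho> \<longrightarrow>
          intrinsic_dist M x y \<le> ereal (c * dist x y)"
    and volume: "\<exists>c>0. \<exists>C>0. \<exists>\<rho>>0. \<forall>x\<in>M. \<forall>\<epsilon>. 0 < \<epsilon> \<and> \<epsilon> < \<rho> \<longrightarrow>
          c * \<epsilon> ^ DIM('a) \<le> measure (normalized_lebesgue M) (intrinsic_ball M x \<epsilon>) \<and>
          measure (normalized_lebesgue M) (intrinsic_ball M x \<epsilon>) \<le> C * \<epsilon> ^ DIM('a)"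
    and rbm: "reflected_brownian_motion M \<Omega> P X"
  shows
    "(\<forall>r>0. \<forall>T>0. \<forall>\<A>.
        (\<forall>q\<le>DIM('a). homological_certificate TYPE('k::field) M q r \<A> \<longrightarrow>
            hit_event \<Omega> X T \<A> \<subseteq> recovery_event TYPE('k) \<Omega> X M q T r) \<and>
        (full_homological_certificate TYPE('k) M r \<A> \<longrightarrow>
            hit_event \<Omega> X T \<A> \<subseteq> full_recovery_event TYPE('k) \<Omega> X M T r)) \<and>
     (\<exists>C_low>0. \<exists>C_up>0. \<exists>\<epsilon>\<^sub>0>0. \<forall>\<epsilon>. 0 < \<epsilon> \<and> \<epsilon> < \<epsilon>\<^sub>0 \<longrightarrow>
        (\<forall>N. intrinsic_net M \<epsilon> N \<and> card N = net_number M \<epsilon> \<longrightarrow>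
           (\<forall>r. C_low * \<epsilon> \<le> r \<and> ereal r \<le> ereal C_up * reach M \<longrightarrow>
              full_homological_certificate TYPE('k) M r ((\<lambda>x. intrinsic_ball M x \<epsilon>) ` N))) \<and>
        (\<exists>\<A>. card \<A> = net_number M \<epsilon> \<and>
           (\<forall>r. C_low * \<epsilon> \<le> r \<and> ereal r \<le> ereal C_up * reach M \<longrightarrow>
              full_homological_certificate TYPE('k) M r \<A>)))"
proof (intro conjI)
  have paths: "continuous_on {0..T} (\<lambda>t. X t \<omega>)" "(\<lambda>t. X t \<omega>) ` {0..T} \<subseteq> M"
    if "\<omega> \<in> space \<Omega>" for \<omega> T
  proof -
    have "continuous_on {0..} (\<lambda>t. X t \<omega>)" "\<forall>t\<ge>0. X t \<omega> \<in> M"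
      using rbm that by (auto simp: reflected_brownian_motion_def continuous_hunt_process_def)
    then show "continuous_on {0..T} (\<lambda>t. X t \<omega>)" "(\<lambda>t. X t \<omega>) ` {0..T} \<subseteq> M"
      by (auto elim: continuous_on_subset)
  qed
  show "\<forall>r>0. \<forall>T>0. \<forall>\<A>.
        (\<forall>q\<le>DIM('a). homological_certificate TYPE('k) M q r \<A> \<longrightarrow>
            hit_event \<Omega> X T \<A> \<subseteq> recovery_event TYPE('k) \<Omega> X M q T r) \<and>
        (full_homological_certificate TYPE('k) M r \<A> \<longrightarrow>
            hit_event \<Omega> X T \<A> \<subseteq> full_recovery_event TYPE('k) \<Omega> X M T r)"
    using paths
    by (auto simp: homological_certificate_def full_homological_certificate_def hit_event_def
        recovery_event_def full_recovery_event_def)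
next
  have cM: "compact M" "M \<noteq> {}"
    using U by (auto simp: M)
  have lq: "locally_quasiconvex M"
    using intrinsic by (simp add: locally_quasiconvex_def)
  have cert: "full_homological_certificate TYPE('k) M r ((\<lambda>x. intrinsic_ball M x \<epsilon>) ` N)"
    if "0 < \<epsilon>" "intrinsic_net M \<epsilon> N" "4 * \<epsilon> \<le> r" "ereal r \<le> ereal (1/8) * reach M" for \<epsilon> r N
    using net_balls_full_certificate[OF cM lq] that by blast
  \<comment> \<open>The family of balls, not the net, must have \<open>net_number M \<epsilon>\<close> elements.\<close>
  have size: "\<exists>N. intrinsic_net M \<epsilon> N \<and> card ((\<lambda>x. intrinsic_ball M x \<epsilon>) ` N) = net_number M \<epsilon>"
    if "0 < \<epsilon>" for \<epsilon>
    using minimal_net_exists[OF lq cM(1) that] by (metis card_image inj_on_minimal_net)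
  show "\<exists>C_low>0. \<exists>C_up>0. \<exists>\<epsilon>\<^sub>0>0. \<forall>\<epsilon>. 0 < \<epsilon> \<and> \<epsilon> < \<epsilon>\<^sub>0 \<longrightarrow>
        (\<forall>N. intrinsic_net M \<epsilon> N \<and> card N = net_number M \<epsilon> \<longrightarrow>
           (\<forall>r. C_low * \<epsilon> \<le> r \<and> ereal r \<le> ereal C_up * reach M \<longrightarrow>
              full_homological_certificate TYPE('k) M r ((\<lambda>x. intrinsic_ball M x \<epsilon>) ` N))) \<and>
        (\<exists>\<A>. card \<A> = net_number M \<epsilon> \<and>
           (\<forall>r. C_low * \<epsilon> \<le> r \<and> ereal r \<le> ereal C_up * reach M \<longrightarrow>
              full_homological_certificate TYPE('k) M r \<A>))"
    \<comment> \<open>The constants of \<open>net_balls_full_certificate\<close>. Every \<open>\<epsilon> > 0\<close> is admissible, so \<open>1\<close> is an arbitrary bound.\<close>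
  proof (rule exI[of _ 4], rule conjI, simp, rule exI[of _ "1/8"], rule conjI, simp,
      rule exI[of _ 1], rule conjI, simp, intro allI impI conjI)
    fix \<epsilon> N r
    assume "0 < \<epsilon> \<and> \<epsilon> < 1" "intrinsic_net M \<epsilon> N \<and> card N = net_number M \<epsilon>"
      "4 * \<epsilon> \<le> r \<and> ereal r \<le> ereal (1/8) * reach M"
    then show "full_homological_certificate TYPE('k) M r ((\<lambda>x. intrinsic_ball M x \<epsilon>) ` N)"
      by (intro cert) auto
  next
    fix \<epsilon> :: real
    assume \<epsilon>: "0 < \<epsilon> \<and> \<epsilon> < 1"
    then show "\<exists>\<A>. card \<A> = net_number M \<epsilon> \<and>
        (\<forall>r. 4 * \<epsilon> \<le> r \<and> ereal r \<le> ereal (1/8) * reach M \<longrightarrow> full_homological_certificate TYPE('k) M r \<A>)"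
      using size cert by metis
  qed
qed

end
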